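(* Let $f:\mathbb{R}\to\mathbb{R}$ be smooth and of bistable type: there is $\alpha\in(0,1)$ with $f(0)=f(\alpha)=f(1)=0$, $f'(0)<0$, $f'(1)<0$, $f'(\alpha)>0$, $f(u)>0$ for $u\in(-\infty,0)\cup(\alpha,1)$ and $f(u)<0$ for $u\in(0,\alpha)\cup(1,+\infty)$. Let $$0<\tau<\tau_m:=\frac{1}{\sup_{u\in[0,1]}|f'(u)|}.$$ Then there exists a unique value $c_\ast\in(-1/\sqrt{\tau},1/\sqrt{\tau})$ for which the system $$u_t=v_x+f(u),\qquad \tau v_t=u_x-v,\qquad (x,t)\in\mathbb{R}\times\mathbb{R}_+,$$ possesses a traveling wave $(u,v)(x,t)=(U,V)(x-c_\ast t)$ connecting the state $(0,0)$ to $(1,0)$, i.e. with $(U,V)(-\infty)=(0,0)$ and $(U,V)(+\infty)=(1,0)$. Moreover: (a) the function $U$ is monotone increasing; (b) both components $U$ and $V$ are positive and converge to their asymptotic states exponentially fast; (c) the speed $c_\ast=c_\ast(\tau)$ depends continuously on $\tau\in(0,\tau_m)$ and converges, as $\tau\to0^+$, to the speed of the traveling front connecting $0$ to $1$ of the parabolic Allen--Cahn equation $u_t=u_{xx}+f(u)$.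
   Context: A traveling wave with speed $c$ is a solution of the form $(u,v)(x,t)=(U,V)(\xi)$, $\xi=x-ct$; equivalently $(U,V)$ solves $cU'+V'+f(U)=0$, $U'+c\tau V'-V=0$. *)

theory Defs
  imports "HOL-Analysis.Analysis"
begin

definition smooth_real :: "(real \<Rightarrow> real) \<Rightarrow> bool" where
  "smooth_real f \<longleftrightarrow> (\<forall>n. (deriv ^^ n) f differentiable_on UNIV)"

definition bistable :: "(real \<Rightarrow> real) \<Rightarrow> real \<Rightarrow> bool" where
  "bistable f \<alpha> \<longleftrightarrow> 0 < \<alpha> \<and> \<alpha> < 1 \<and>
     f 0 = 0 \<and> f \<alpha> = 0 \<and> f 1 = 0 \<and>
     deriv f 0 < 0 \<and> deriv f 1 < 0 \<and> deriv f \<alpha> > 0 \<and>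
     (\<forall>u. (u < 0 \<or> (\<alpha> < u \<and> u < 1)) \<longrightarrow> f u > 0) \<and>
     (\<forall>u. ((0 < u \<and> u < \<alpha>) \<or> 1 < u) \<longrightarrow> f u < 0)"

definition tau_max :: "(real \<Rightarrow> real) \<Rightarrow> real" where
  "tau_max f = 1 / Sup ((\<lambda>u. \<bar>deriv f u\<bar>) ` {0..1})"

text \<open>(U,V) is a (C^1) traveling wave profile of speed c for
  u_t = v_x + f(u), tau v_t = u_x - v, connecting (0,0) at -infinity to (1,0) at +infinity:
  c U' + V' + f(U) = 0 and U' + c tau V' - V = 0.\<close>
definition hyp_front :: "(real \<Rightarrow> real) \<Rightarrow> real \<Rightarrow> real \<Rightarrow> (real \<Rightarrow> real) \<Rightarrow> (real \<Rightarrow> real) \<Rightarrow> bool" where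
  "hyp_front f \<tau> c U V \<longleftrightarrow>
     U differentiable_on UNIV \<and> V differentiable_on UNIV \<and>
     (\<forall>\<xi>. c * deriv U \<xi> + deriv V \<xi> + f (U \<xi>) = 0) \<and>
     (\<forall>\<xi>. deriv U \<xi> + c * \<tau> * deriv V \<xi> - V \<xi> = 0) \<and>
     (U \<longlongrightarrow> 0) at_bot \<and> (V \<longlongrightarrow> 0) at_bot \<and>
     (U \<longlongrightarrow> 1) at_top \<and> (V \<longlongrightarrow> 0) at_top"

text \<open>U is a (C^2) traveling front of speed c for the Allen--Cahn equation u_t = u_xx + f(u)
  connecting 0 (at -infinity) to 1 (at +infinity): U'' + c U' + f(U) = 0.\<close>
definition parab_front :: "(real \<Rightarrow> real) \<Rightarrow> real \<Rightarrow> (real \<Rightarrow> real) \<Rightarrow> bool" where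
  "parab_front f c U \<longleftrightarrow>
     U differentiable_on UNIV \<and> deriv U differentiable_on UNIV \<and>
     (\<forall>\<xi>. deriv (deriv U) \<xi> + c * deriv U \<xi> + f (U \<xi>) = 0) \<and>
     (U \<longlongrightarrow> 0) at_bot \<and> (U \<longlongrightarrow> 1) at_top"

definition exp_convergent :: "(real \<Rightarrow> real) \<Rightarrow> (real \<Rightarrow> real) \<Rightarrow> bool" where
  "exp_convergent U V \<longleftrightarrow> (\<exists>C \<mu>. C > 0 \<and> \<mu> > 0 \<and>
     (\<forall>\<xi>\<le>0. \<bar>U \<xi>\<bar> + \<bar>V \<xi>\<bar> \<le> C * exp (\<mu> * \<xi>)) \<and>
     (\<forall>\<xi>\<ge>0. \<bar>U \<xi> - 1\<bar> + \<bar>V \<xi>\<bar> \<le> C * exp (- \<mu> * \<xi>)))"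

end

theory Submission
  imports Defs
begin

text \<open>
  Eliminating \<open>V\<close> and rescaling \<open>\<xi>\<close> by \<open>\<surd>(1 - c\<^sup>2\<tau>)\<close> turns the profile equations into
  \<open>u'' + s g(u) u' + f(u) = 0\<close> with \<open>s = c / \<surd>(1 - c\<^sup>2\<tau>)\<close> and \<open>g = 1 - \<tau> f'\<close>, and \<open>g > 0\<close> on
  \<open>[0,1]\<close> because \<open>\<tau> < \<tau>\<^sub>m\<close>; \<open>\<tau> = 0\<close> is the parabolic problem. A monotone front is a solution
  \<open>p > 0\<close> of \<open>p' = - s g - f / p\<close> on \<open>(0,1)\<close> vanishing at \<open>0\<close> and \<open>1\<close>. On \<open>[0,\<alpha>]\<close>, where
  \<open>f \<le> 0\<close>, this equation is contractive in the forward direction, on \<open>[\<alpha>,1]\<close> in the backward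
  direction; so the orbits leaving \<open>0\<close> and entering \<open>1\<close> are unique, and their heights at
  \<open>u = \<alpha>\<close> are monotone in \<open>s\<close> and Lipschitz in \<open>s g\<close>. The heights agree for exactly one \<open>s\<close>,
  which therefore depends continuously on \<open>\<tau> \<in> [0,\<tau>\<^sub>m)\<close>. An arbitrary front stays in \<open>(0,1)\<close> by the
  maximum principle and is increasing by an energy argument, so it is one of these.
\<close>

section \<open>Real analysis\<close>

text \<open>At both ends the phase-plane equation reads 0 / 0, so no classical theorem gives the
  orbits there. What replaces it is that \<open>- f / p\<close> is monotone in \<open>p\<close> in a
  direction fixed by the sign of \<open>f\<close>, a property that survives regularisation and
  limits.

  The heights at \<alpha> are only weakly monotone in \<open>s\<close>, and an orbit may arrive
  there with height zero, so uniqueness of the matching \<open>s\<close> is not read off from them.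
  It comes from comparing an arbitrary front with one known orbit along the time of the front,
  without writing the front as a graph over \<open>u\<close>; the strict sign of the mismatch
  follows afterwards.

  Only one end and one sign of \<open>s\<close> are treated by hand: replacing \<open>u\<close> by
  \<open>1 - u\<close>, \<open>t\<close> by \<open>- t\<close> and \<open>s\<close> by
  \<open>- s\<close> preserves the class of problems and exchanges the ends.

  Working with \<open>s\<close> instead of \<open>c\<close> removes the constraint on the speed:
  \<open>c = s / sqrt (1 + s^2 * \<tau>)\<close> maps the line onto the open interval between
  \<open>- 1 / sqrt \<tau>\<close> and \<open>1 / sqrt \<tau>\<close>, and \<tau> = 0 becomes an
  ordinary point of the family.\<close>

lemma nonneg_by_barrier:
  fixes d :: "real \<Rightarrow> real"
  assumes cont: "continuous_on {a..b} d" and a: "0 \<le> d a"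
    and der: "\<And>x. a < x \<Longrightarrow> x < b \<Longrightarrow> d x < 0 \<Longrightarrow> \<exists>y. (d has_real_derivative y) (at x) \<and> 0 \<le> y"
    and x: "x \<in> {a..b}"
  shows "0 \<le> d x"
proof (rule ccontr)
  assume neg: "\<not> 0 \<le> d x"
  have contx: "continuous_on {a..x} d"
    by (rule continuous_on_subset[OF cont]) (use x in auto)
  \<comment> \<open>The last point of \<open>S\<close> is followed by negative values only, so the
    hypothesis applies there and \<open>d\<close> cannot drop. Asking for the derivative only where
    \<open>d < 0\<close> lets later comparisons use the order of two solutions when estimating their
    slopes.\<close>
  define S where "S = {a..x} \<inter> d -` {0..}"
  have "closed S"
    unfolding S_def by (rule continuous_closed_preimage[OF contx]) auto
  moreover have "bounded S"
    by (rule bounded_subset[of "{a..x}"]) (auto simp: S_def)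
  ultimately have "compact S"
    by (simp add: compact_eq_bounded_closed)
  moreover have "a \<in> S"
    using a x by (auto simp: S_def)
  ultimately obtain m where m: "m \<in> S" "\<And>y. y \<in> S \<Longrightarrow> y \<le> m"
    using compact_attains_sup[of S] by auto
  have mx: "a \<le> m" "m < x" "0 \<le> d m"
    using m(1) neg by (auto simp: S_def less_le)
  have below: "d y < 0" if "m < y" "y \<le> x" for y
    using m(2)[of y] that mx by (force simp: S_def)
  have "d m \<le> d x"
  proof (rule DERIV_nonneg_imp_increasing_open[where f = d])
    show "m \<le> x" using mx by simp
    show "continuous_on {m..x} d"
      by (rule continuous_on_subset[OF contx]) (use mx in auto)
    show "\<exists>z. (d has_real_derivative z) (at y) \<and> 0 \<le> z" if "m < y" "y < x" for y
      using that mx x below[of y] by (intro der) auto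
  qed
  with mx neg show False by simp
qed

lemma continuous_on_Icc_abs_bound:
  fixes f :: "real \<Rightarrow> real"
  assumes "continuous_on {a..b} f"
  obtains B where "0 < B" "\<And>x. x \<in> {a..b} \<Longrightarrow> \<bar>f x\<bar> \<le> B"
proof -
  have "bounded (f ` {a..b})"
    by (intro compact_imp_bounded compact_continuous_image assms compact_Icc)
  then show ?thesis
    using that by (auto simp: bounded_pos)
qed

text \<open>The weight \<open>exp (- 2 * K * t)\<close> makes the integral operator a contraction
  with factor \<open>K / L = 1 / 2\<close> on the whole interval, so local solutions need not be
  continued.\<close>

lemma picard_lindelof_on_interval:
  fixes F :: "real \<Rightarrow> real \<Rightarrow> real"
  assumes a: "0 < a" and K: "0 < K"
    and cont: "\<And>w. continuous_on {0..a} w \<Longrightarrow> continuous_on {0..a} (\<lambda>t. F t (w t))"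
    and lip: "\<And>t x y. t \<in> {0..a} \<Longrightarrow> \<bar>F t x - F t y\<bar> \<le> K * \<bar>x - y\<bar>"
  obtains p where "continuous_on {0..a} p"
    "\<And>u. u \<in> {0..a} \<Longrightarrow> p u = p0 + integral {0..u} (\<lambda>t. F t (p t))"
proof -
  define L where "L = 2 * K"
  define G where "G w v = exp (- L * v) * (p0 + integral {0..v} (\<lambda>t. F t (exp (L * t) * w t)))"
    for w :: "real \<Rightarrow> real" and v
  \<comment> \<open>Clamping to \<open>{0..a}\<close> turns functions on the interval into bounded
    continuous functions on the line, the complete space in which the fixed point is taken.\<close>
  define cl where "cl u = max 0 (min a u)" for u :: real
  have cl_in: "cl u \<in> {0..a}" for u
    using a by (auto simp: cl_def)
  have cl_id: "cl u = u" if "u \<in> {0..a}" for u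
    using that by (auto simp: cl_def)
  have cl_cont: "continuous_on UNIV cl"
    unfolding cl_def by (intro continuous_intros)
  have intg: "continuous_on {0..a} (\<lambda>t. F t (exp (L * t) * w t))" if "continuous_on {0..a} w" for w
    by (intro cont continuous_intros that)
  have G_cont: "continuous_on {0..a} (G w)" if "continuous_on {0..a} w" for w
    unfolding G_def
    by (intro continuous_intros indefinite_integral_continuous_1 integrable_continuous_real intg that)
  have bc: "continuous_on X (apply_bcontfun w)" for w :: "real \<Rightarrow>\<^sub>C real" and X
    by (intro continuous_on_apply_bcontfun continuous_intros)
  define S where "S w = Bcontfun (\<lambda>u. G (apply_bcontfun w) (cl u))" for w
  have S_in: "(\<lambda>u. G (apply_bcontfun w) (cl u)) \<in> bcontfun" for w
  proof -
    obtain B where "\<And>v. v \<in> {0..a} \<Longrightarrow> \<bar>G (apply_bcontfun w) v\<bar> \<le> B"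
      using continuous_on_Icc_abs_bound[OF G_cont[OF bc]] by blast
    then show ?thesis
      using cl_in
      by (intro bcontfun_normI[of _ B] continuous_on_compose2[OF G_cont[OF bc] cl_cont]) auto
  qed
  have S_app: "apply_bcontfun (S w) u = G (apply_bcontfun w) (cl u)" for w u
    by (simp add: S_def Bcontfun_inverse[OF S_in])
  have contr: "dist (S w1) (S w2) \<le> 1 / 2 * dist w1 w2" for w1 w2
  proof (rule dist_bound)
    fix u
    define v where "v = cl u"
    define \<delta> where "\<delta> = dist w1 w2"
    have v: "0 \<le> v" "v \<le> a" using cl_in[of u] by (auto simp: v_def)
    let ?r = "\<lambda>w t. F t (exp (L * t) * apply_bcontfun w t)"
    have int: "?r w integrable_on {0..v}" for w
      by (intro integrable_continuous_real continuous_on_subset[OF intg[OF bc]]) (use v in auto)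
    have ftc: "((\<lambda>t. K * \<delta> * exp (L * t)) has_integral (\<delta> / 2 * exp (L * v) - \<delta> / 2 * exp (L * 0))) {0..v}"
      using v by (intro fundamental_theorem_of_calculus)
        (auto intro!: derivative_eq_intros simp: L_def has_real_derivative_iff_has_vector_derivative[symmetric])
    have "norm (integral {0..v} (\<lambda>t. ?r w1 t - ?r w2 t)) \<le> integral {0..v} (\<lambda>t. K * \<delta> * exp (L * t))"
    proof (rule integral_norm_bound_integral)
      show "(\<lambda>t. ?r w1 t - ?r w2 t) integrable_on {0..v}"
        by (intro integrable_diff int)
      show "(\<lambda>t. K * \<delta> * exp (L * t)) integrable_on {0..v}"
        using ftc by blast
      fix t assume t: "t \<in> {0..v}"
      have "norm (?r w1 t - ?r w2 t) \<le> K * \<bar>exp (L * t) * apply_bcontfun w1 t - exp (L * t) * apply_bcontfun w2 t\<bar>"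
        using lip[of t] t v by auto
      also have "\<dots> = K * (exp (L * t) * \<bar>apply_bcontfun w1 t - apply_bcontfun w2 t\<bar>)"
        by (simp add: abs_mult flip: right_diff_distrib)
      also have "\<dots> \<le> K * (exp (L * t) * \<delta>)"
        using dist_bounded[of w1 t w2] K by (intro mult_left_mono) (auto simp: \<delta>_def dist_real_def)
      finally show "norm (?r w1 t - ?r w2 t) \<le> K * \<delta> * exp (L * t)"
        by (simp add: mult_ac)
    qed
    also have "\<dots> \<le> \<delta> / 2 * exp (L * v)"
      using integral_unique[OF ftc] by (simp add: \<delta>_def)
    finally have bd: "\<bar>integral {0..v} (?r w1) - integral {0..v} (?r w2)\<bar> \<le> \<delta> / 2 * exp (L * v)"
      by (simp add: integral_diff[OF int int])
    have "dist (S w1 u) (S w2 u) = exp (- L * v) * \<bar>integral {0..v} (?r w1) - integral {0..v} (?r w2)\<bar>"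
      unfolding S_app G_def v_def[symmetric] dist_real_def right_diff_distrib[symmetric] abs_mult
      by simp
    also have "\<dots> \<le> exp (- L * v) * (\<delta> / 2 * exp (L * v))"
      by (intro mult_left_mono bd) auto
    also have "\<dots> = \<delta> / 2"
      by (simp add: exp_minus field_simps)
    finally show "dist (S w1 u) (S w2 u) \<le> 1 / 2 * dist w1 w2"
      by (simp add: \<delta>_def)
  qed
  obtain w where w: "S w = w"
    using banach_fix_type[of "1/2" S] contr by auto
  define p where "p t = exp (L * t) * apply_bcontfun w t" for t
  have pc: "continuous_on {0..a} p"
    unfolding p_def by (intro continuous_intros bc)
  have "p u = p0 + integral {0..u} (\<lambda>t. F t (p t))" if "u \<in> {0..a}" for u
  proof -
    have "apply_bcontfun w u = G (apply_bcontfun w) u"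
      using S_app[of w u] cl_id[OF that] w by simp
    then show ?thesis
      unfolding p_def by (simp add: G_def exp_minus field_simps)
  qed
  with pc show ?thesis by (rule that)
qed

section \<open>Reflection, time reversal, rescaling and behaviour at infinity\<close>

abbreviation (input) reflect :: "(real \<Rightarrow> real) \<Rightarrow> real \<Rightarrow> real" where
  "reflect g \<equiv> \<lambda>x. g (1 - x)"

lemma DERIV_reflect:
  assumes "(p has_real_derivative l) (at (1 - x))"
  shows "(reflect p has_real_derivative - l) (at x)"
proof -
  have "((\<lambda>x. 1 - x) has_real_derivative - 1) (at x)"
    by (auto intro!: derivative_eq_intros)
  from DERIV_chain2[OF assms this] show ?thesis by simp
qed

lemma DERIV_mirror_minus:
  fixes u :: "real \<Rightarrow> real"
  assumes "(u has_real_derivative l) (at (- x))"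
  shows "((\<lambda>x. u (- x)) has_real_derivative - l) (at x)"
proof -
  have "((\<lambda>x::real. - x) has_real_derivative - 1) (at x)"
    by (auto intro!: derivative_eq_intros)
  from DERIV_chain2[OF assms this] show ?thesis by simp
qed

lemma tendsto_rescale:
  fixes u :: "real \<Rightarrow> real"
  assumes "0 < r"
  shows "(u \<longlongrightarrow> l) at_bot \<Longrightarrow> ((\<lambda>t. u (r * t)) \<longlongrightarrow> l) at_bot"
    and "(u \<longlongrightarrow> l) at_top \<Longrightarrow> ((\<lambda>t. u (r * t)) \<longlongrightarrow> l) at_top"
  by (erule filterlim_compose, rule filterlim_tendsto_pos_mult_at_bot[OF tendsto_const assms filterlim_ident])
    (erule filterlim_compose, rule filterlim_tendsto_pos_mult_at_top[OF tendsto_const assms filterlim_ident])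

lemma DERIV_rescale:
  fixes u :: "real \<Rightarrow> real"
  assumes "(u has_real_derivative l) (at (r * t))"
  shows "((\<lambda>t. u (r * t)) has_real_derivative r * l) (at t)"
proof -
  have "((\<lambda>t. r * t) has_real_derivative r) (at t)"
    by (auto intro!: derivative_eq_intros)
  from DERIV_chain2[OF assms this] show ?thesis by (simp add: mult.commute)
qed

lemma at_bot_limit_attains_max:
  fixes u :: "real \<Rightarrow> real"
  assumes cont: "continuous_on UNIV u" and lim: "(u \<longlongrightarrow> l) at_bot" and gt: "l < u t"
  obtains m where "m \<le> t" "\<And>x. x \<le> t \<Longrightarrow> u x \<le> u m"
proof -
  obtain A where A: "\<And>x. x \<le> A \<Longrightarrow> u x < u t"
    using order_tendstoD(2)[OF lim gt] by (auto simp: eventually_at_bot_linorder)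
  have "A < t" using A[of t] by force
  then obtain m where m: "m \<in> {A..t}" "\<And>x. x \<in> {A..t} \<Longrightarrow> u x \<le> u m"
    using continuous_attains_sup[of "{A..t}" u] continuous_on_subset[OF cont] by auto
  show ?thesis
  proof
    show "m \<le> t" using m by simp
    show "u x \<le> u m" if "x \<le> t" for x
    proof (cases "x \<le> A")
      case True
      then show ?thesis using A[of x] m(2)[of t] \<open>A < t\<close> by simp
    qed (use m(2)[of x] that in auto)
  qed
qed

lemma strict_local_max_second_derivative:
  fixes u y :: "real \<Rightarrow> real"
  assumes u: "\<And>t. (u has_real_derivative y t) (at t)"
    and y: "(y has_real_derivative l) (at t)" "y t = 0" "l < 0"
  obtains e where "0 < e" "\<And>h. 0 < h \<Longrightarrow> h < e \<Longrightarrow> u (t + h) < u t" "\<And>h. 0 < h \<Longrightarrow> h < e \<Longrightarrow> u (t - h) < u t"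
proof -
  have uc: "continuous_on X u" for X
    using u by (intro DERIV_continuous_on) (auto intro: has_field_derivative_at_within)
  obtain d1 where d1: "0 < d1" "\<And>h. 0 < h \<Longrightarrow> h < d1 \<Longrightarrow> 0 < y (t - h)"
    using DERIV_neg_dec_left[OF y(1,3)] y(2) by auto
  obtain d2 where d2: "0 < d2" "\<And>h. 0 < h \<Longrightarrow> h < d2 \<Longrightarrow> y (t + h) < 0"
    using has_real_derivative_neg_dec_right[OF y(1,3)] y(2) by auto
  show ?thesis
  proof (rule that[of "min d1 d2"])
    show "0 < min d1 d2" using d1 d2 by simp
    fix h assume h: "0 < h" "h < min d1 d2"
    show "u (t + h) < u t"
    proof (rule DERIV_neg_imp_decreasing_open[where f = u])
      fix x assume "t < x" "x < t + h"
      then show "\<exists>l. (u has_real_derivative l) (at x) \<and> l < 0"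
        using d2(2)[of "x - t"] h u[of x] by auto
    qed (use h uc in auto)
    show "u (t - h) < u t"
    proof (rule DERIV_pos_imp_increasing_open[where f = u])
      fix x assume "t - h < x" "x < t"
      then show "\<exists>l. (u has_real_derivative l) (at x) \<and> 0 < l"
        using d1(2)[of "t - x"] h u[of x] by auto
    qed (use h uc in auto)
  qed
qed

text \<open>Serves to glue two half orbits at \<alpha>: the mean value theorem turns each difference
  quotient at \<open>c\<close> into a value of \<open>R\<close> at a nearby point, and
  \<open>R\<close> is continuous at \<open>c\<close>.\<close>

lemma DERIV_of_punctured_derivative:
  fixes p R :: "real \<Rightarrow> real"
  assumes ab: "a < c" "c < b" and p: "isCont p c" and R: "isCont R c"
    and der: "\<And>x. a < x \<Longrightarrow> x < b \<Longrightarrow> x \<noteq> c \<Longrightarrow> (p has_real_derivative R x) (at x)"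
  shows "(p has_real_derivative R c) (at c)"
  unfolding has_field_derivative_iff
proof (rule LIM_I)
  fix r :: real assume "0 < r"
  then obtain d where d: "0 < d" "\<And>x. \<bar>x - c\<bar> < d \<Longrightarrow> \<bar>R x - R c\<bar> < r"
    using R unfolding continuous_at_eps_delta dist_real_def by blast
  have cont: "continuous_on {x..y} p" if "a < x" "y < b" for x y
  proof (intro continuous_at_imp_continuous_on ballI)
    fix z assume "z \<in> {x..y}"
    then show "isCont p z"
      using p der[of z] DERIV_isCont that by (cases "z = c") auto
  qed
  have diff: "p differentiable at z" if "a < z" "z < b" "z \<noteq> c" for z
    using der[OF that] by (auto simp: real_differentiable_def)
  have "\<bar>(p y - p c) / (y - c) - R c\<bar> < r"
    if y: "y \<noteq> c" "\<bar>y - c\<bar> < min d (min (c - a) (b - c))" for y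
  proof (cases "c < y")
    case True
    then obtain l z where z: "c < z" "z < y" "(p has_real_derivative l) (at z)" "p y - p c = (y - c) * l"
      using MVT[of c y p] cont[of c y] diff y ab by fastforce
    then have "l = R z" using DERIV_unique[OF z(3) der[of z]] y ab True by auto
    then show ?thesis using z d(2)[of z] y by simp
  next
    case False
    then have "y < c" using y by simp
    then obtain l z where z: "y < z" "z < c" "(p has_real_derivative l) (at z)" "p c - p y = (c - y) * l"
      using MVT[of y c p] cont[of y c] diff y ab by fastforce
    then have "l = R z" using DERIV_unique[OF z(3) der[of z]] y ab \<open>y < c\<close> by auto
    moreover have "(p y - p c) / (y - c) = l" using z by (simp add: field_simps)
    ultimately show ?thesis using z d(2)[of z] y by simp
  qed
  then show "\<exists>e>0. \<forall>y. y \<noteq> c \<and> norm (y - c) < e \<longrightarrow> norm ((p y - p c) / (y - c) - R c) < r"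
    using d(1) ab by (intro exI[of _ "min d (min (c - a) (b - c))"]) auto
qed

text \<open>As \<open>p\<close> vanishes at least linearly at 0, \<open>1 / p\<close> dominates
  \<open>1 / (C * x)\<close>, which is not integrable there: a front needs infinite time to leave
  its rest state.\<close>

lemma reciprocal_antiderivative_unbounded:
  fixes X p :: "real \<Rightarrow> real"
  assumes X: "\<And>x. 0 < x \<Longrightarrow> x < 1 \<Longrightarrow> (X has_real_derivative 1 / p x) (at x)"
    and p: "\<And>x. 0 < x \<Longrightarrow> x < 1 \<Longrightarrow> 0 < p x" "\<And>x. 0 < x \<Longrightarrow> x < 1 \<Longrightarrow> p x \<le> C * x" and C: "0 < C"
  obtains x where "0 < x" "x < 1" "X x \<le> t"
proof -
  \<comment> \<open>Comparison with \<open>ln x / C\<close> gives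
    \<open>X x \<le> X (1 / 2) + (ln x - ln (1 / 2)) / C\<close>; the exponential is the point at
    which the right side equals \<open>t\<close>.\<close>
  define x where "x = min (1 / 2) (exp (ln (1 / 2) + C * (t - X (1 / 2))))"
  have x: "0 < x" "x \<le> 1 / 2" by (auto simp: x_def)
  have "ln x \<le> ln (exp (ln (1 / 2) + C * (t - X (1 / 2))))"
    using x(1) by (subst ln_le_cancel_iff) (auto simp: x_def)
  then have lnx: "ln x \<le> ln (1 / 2) + C * (t - X (1 / 2))" by simp
  have "X x - ln x / C \<le> X (1 / 2) - ln (1 / 2) / C"
  proof (rule DERIV_nonneg_imp_nondecreasing[where f = "\<lambda>x. X x - ln x / C"])
    show "x \<le> 1 / 2" by (rule x)
    fix z assume z: "x \<le> z" "z \<le> 1 / 2"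
    then have z0: "0 < z" "z < 1" using x by auto
    have "((\<lambda>x. X x - ln x / C) has_real_derivative (1 / p z - 1 / z / C)) (at z)"
      using z0 C by (auto intro!: derivative_eq_intros X)
    moreover have "1 / (C * z) \<le> 1 / p z"
      using p[OF z0] by (intro divide_left_mono mult_pos_pos) (use C z0 in auto)
    ultimately show "\<exists>l. ((\<lambda>x. X x - ln x / C) has_real_derivative l) (at z) \<and> 0 \<le> l"
      by (intro exI conjI) (auto simp: mult.commute)
  qed
  moreover have "ln x / C \<le> ln (1 / 2) / C + (t - X (1 / 2))"
    using lnx C by (simp add: field_simps)
  ultimately have "X x \<le> t" by linarith
  with x show ?thesis by (intro that[of x]) auto
qed

text \<open>Separation of variables: \<open>u\<close> is the inverse of an antiderivative
  \<open>X\<close> of \<open>1 / p\<close>. The linear bounds at both ends make \<open>X\<close>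
  onto the real line, so \<open>u\<close> exists for all times and reaches 0 and 1 only in the
  limit.\<close>

lemma autonomous_connection:
  fixes p :: "real \<Rightarrow> real"
  assumes p: "\<And>x. 0 < x \<Longrightarrow> x < 1 \<Longrightarrow> 0 < p x" "\<And>x. 0 < x \<Longrightarrow> x < 1 \<Longrightarrow> isCont p x"
    and C: "0 < C" "\<And>x. 0 < x \<Longrightarrow> x < 1 \<Longrightarrow> p x \<le> C * x" "\<And>x. 0 < x \<Longrightarrow> x < 1 \<Longrightarrow> p x \<le> C * (1 - x)"
  obtains u where "\<And>t. 0 < u t" "\<And>t. u t < 1" "\<And>t. (u has_real_derivative p (u t)) (at t)"
    "(u \<longlongrightarrow> 0) at_bot" "(u \<longlongrightarrow> 1) at_top"
proof -
  have "\<exists>X. \<forall>x. ereal 0 < ereal x \<longrightarrow> ereal x < ereal 1 \<longrightarrow> (X has_vector_derivative 1 / p x) (at x)"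
  proof (rule einterval_antiderivative)
    fix x assume "ereal 0 < ereal x" "ereal x < ereal 1"
    then show "isCont (\<lambda>x. 1 / p x) x"
      using p[of x] by (auto intro!: continuous_intros)
  qed simp
  then obtain X where X: "\<And>x. 0 < x \<Longrightarrow> x < 1 \<Longrightarrow> (X has_real_derivative 1 / p x) (at x)"
    by (auto simp: has_real_derivative_iff_has_vector_derivative)
  have Xmono: "X a < X b" if ab: "0 < a" "a < b" "b < 1" for a b
  proof (rule DERIV_pos_imp_increasing[where f = X, OF ab(2)])
    fix x assume "a \<le> x" "x \<le> b"
    then show "\<exists>y. (X has_real_derivative y) (at x) \<and> 0 < y"
      using X[of x] p(1)[of x] ab by (intro exI[of _ "1 / p x"]) auto
  qed
  have Xmono_iff: "X a < X b \<longleftrightarrow> a < b" if "0 < a" "a < 1" "0 < b" "b < 1" for a b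
    using Xmono[of a b] Xmono[of b a] that by (cases a b rule: linorder_cases) auto
  have "\<exists>x. 0 < x \<and> x < 1 \<and> X x = t" for t
  proof -
    obtain l where l: "0 < l" "l < 1" "X l \<le> t"
      by (rule reciprocal_antiderivative_unbounded[where X = X and p = p and C = C and t = t])
        (use X p C in auto)
    obtain r where r: "0 < r" "r < 1" "- X (1 - r) \<le> - t"
    proof (rule reciprocal_antiderivative_unbounded
        [where X = "\<lambda>x. - X (1 - x)" and p = "reflect p" and C = C and t = "- t"])
      fix x :: real assume x: "0 < x" "x < 1"
      show "((\<lambda>x. - X (1 - x)) has_real_derivative 1 / p (1 - x)) (at x)"
        using DERIV_minus[OF DERIV_reflect[OF X, of x]] x by simp
      show "0 < p (1 - x)" "p (1 - x) \<le> C * x"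
        using p(1)[of "1 - x"] C(3)[of "1 - x"] x by auto
    qed (use C in auto)
    have lr: "l \<le> 1 - r"
      using Xmono[of "1 - r" l] l r by force
    have "\<exists>x\<ge>l. x \<le> 1 - r \<and> X x = t"
      using l r lr by (intro IVT) (auto intro!: DERIV_isCont[OF X])
    then obtain x where "l \<le> x" "x \<le> 1 - r" "X x = t" by blast
    then show ?thesis using l r by (intro exI[of _ x]) auto
  qed
  then obtain u where u: "\<And>t. 0 < u t" "\<And>t. u t < 1" "\<And>t. X (u t) = t" by metis
  have uX: "u (X x) = x" if "0 < x" "x < 1" for x
    using u[of "X x"] Xmono[of x "u (X x)"] Xmono[of "u (X x)" x] that
    by (cases x "u (X x)" rule: linorder_cases) auto
  have ucont: "isCont u t" for t
  proof -
    define a b where "a = u t / 2" and "b = (u t + 1) / 2"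
    have ab: "0 < a" "a < u t" "u t < b" "b < 1" using u[of t] by (auto simp: a_def b_def)
    have "isCont u (X (u t))"
    proof (rule isCont_inverse_function2[of a "u t" b])
      fix z assume "a \<le> z" "z \<le> b"
      then have z: "0 < z" "z < 1" using ab by auto
      show "u (X z) = z" "isCont X z" using uX[OF z] DERIV_isCont[OF X[OF z]] by auto
    qed (use ab in auto)
    then show ?thesis by (simp add: u)
  qed
  have uder: "(u has_real_derivative p (u t)) (at t)" for t
  proof -
    have "(u has_real_derivative inverse (1 / p (u t))) (at t)"
      by (rule DERIV_inverse_function[where f = X and a = "t - 1" and b = "t + 1"])
        (use u X p(1)[of "u t"] ucont in \<open>auto simp: less_imp_neq[THEN not_sym]\<close>)
    then show ?thesis by simp
  qed
  have ult: "u t < a" if "t < X a" "0 < a" "a < 1" for t a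
    using Xmono_iff[of "u t" a] u[of t] that by auto
  have ugt: "a < u t" if "X a < t" "0 < a" "a < 1" for t a
    using Xmono_iff[of a "u t"] u[of t] that by auto
  show ?thesis
  proof (rule that[OF u(1,2) uder])
    show "(u \<longlongrightarrow> 0) at_bot"
    proof (rule order_tendstoI)
      fix a :: real assume "0 < a"
      then have m: "0 < min a (1 / 2)" "min a (1 / 2) < 1" by auto
      have "u t < a" if "t < X (min a (1 / 2))" for t
        using ult[OF that m] by simp
      then show "eventually (\<lambda>t. u t < a) at_bot"
        using eventually_gt_at_bot by (rule eventually_mono[rotated])
    next
      fix a :: real assume "a < 0"
      then have "a < u t" for t using u(1)[of t] by simp
      then show "eventually (\<lambda>t. a < u t) at_bot" by (intro always_eventually allI)
    qed
    show "(u \<longlongrightarrow> 1) at_top"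
    proof (rule order_tendstoI)
      fix a :: real assume "a < 1"
      then have m: "0 < max a (1 / 2)" "max a (1 / 2) < 1" by auto
      have "a < u t" if "X (max a (1 / 2)) < t" for t
        using ugt[OF that m] by simp
      then show "eventually (\<lambda>t. a < u t) at_top"
        using eventually_gt_at_top by (rule eventually_mono[rotated])
    next
      fix a :: real assume "1 < a"
      then have "u t < a" for t using u(2)[of t] by simp
      then show "eventually (\<lambda>t. u t < a) at_top" by (intro always_eventually allI)
    qed
  qed
qed

text \<open>A \<open>parab_front\<close> carries no condition on the derivative at infinity; this
  supplies it. In every unit interval some \<open>y z\<close> is a small increment of
  \<open>u\<close>, and \<open>y + c * u\<close>, whose derivative is \<open>- r\<close>, carries
  the smallness back from \<open>z\<close> to \<open>t\<close>.\<close>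

lemma derivative_vanishes_at_top:
  fixes u y :: "real \<Rightarrow> real"
  assumes u: "\<And>t. (u has_real_derivative y t) (at t)" and lim: "(u \<longlongrightarrow> l) at_top"
    and w: "\<And>t. (y has_real_derivative (- c * y t - r t)) (at t)" and r: "(r \<longlongrightarrow> 0) at_top"
  shows "(y \<longlongrightarrow> 0) at_top"
proof (rule tendstoI)
  fix e :: real assume e: "0 < e"
  define d where "d = e / (4 + 4 * \<bar>c\<bar>)"
  have d: "0 < d" using e by (simp add: d_def)
  have "eventually (\<lambda>t. dist (u t) l < d) at_top" "eventually (\<lambda>t. dist (r t) 0 < d) at_top"
    using tendstoD[OF lim d] tendstoD[OF r d] by auto
  then have "eventually (\<lambda>t. \<bar>u t - l\<bar> < d \<and> \<bar>r t\<bar> < d) at_top"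
    by eventually_elim (simp add: dist_real_def)
  then obtain N where N: "\<And>t. N \<le> t \<Longrightarrow> \<bar>u t - l\<bar> < d" "\<And>t. N \<le> t \<Longrightarrow> \<bar>r t\<bar> < d"
    by (auto simp: eventually_at_top_linorder)
  have "\<bar>y t\<bar> < e" if t: "N \<le> t" for t
  proof -
    obtain z where z: "t < z" "z < t + 1" "u (t + 1) - u t = (t + 1 - t) * y z"
      using MVT2[of t "t + 1" u y] u by auto
    have wd: "((\<lambda>t. y t + c * u t) has_real_derivative - r x) (at x)" for x
      by (auto intro!: derivative_eq_intros u w)
    obtain x where x: "t < x" "x < z" "y z + c * u z - (y t + c * u t) = (z - t) * - r x"
      using MVT2[of t z "\<lambda>t. y t + c * u t" "\<lambda>x. - r x"] wd z by auto
    have "\<bar>(z - t) * - r x\<bar> \<le> 1 * \<bar>r x\<bar>"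
      unfolding abs_mult using z x by (intro mult_mono) auto
    then have 1: "\<bar>(z - t) * - r x\<bar> < d" using N(2)[of x] x t by linarith
    have "u (t + 1) - u t = y z" using z(3) by simp
    then have 2: "\<bar>y z\<bar> < 2 * d" using N(1)[of t] N(1)[of "t + 1"] t by linarith
    have "\<bar>u z - u t\<bar> \<le> 2 * d" using N(1)[of t] N(1)[of z] t z by linarith
    then have "\<bar>c\<bar> * \<bar>u z - u t\<bar> \<le> \<bar>c\<bar> * (2 * d)" by (rule mult_left_mono) simp
    then have 3: "\<bar>c * u z - c * u t\<bar> \<le> \<bar>c\<bar> * (2 * d)"
      by (simp add: abs_mult flip: right_diff_distrib)
    have "\<bar>y t\<bar> < 3 * d + \<bar>c\<bar> * (2 * d)"
      using 1 2 3 x(3) by linarith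
    also have "\<dots> \<le> d * (4 + 4 * \<bar>c\<bar>)"
      using d by (simp add: algebra_simps)
    also have "\<dots> = e"
    proof -
      have "4 + 4 * \<bar>c\<bar> \<noteq> 0" using abs_ge_zero[of c] by linarith
      then show ?thesis by (simp add: d_def)
    qed
    finally show ?thesis .
  qed
  then show "eventually (\<lambda>t. dist (y t) 0 < e) at_top"
    by (auto simp: eventually_at_top_linorder)
qed

lemma derivative_vanishes_at_bot:
  fixes u y :: "real \<Rightarrow> real"
  assumes u: "\<And>t. (u has_real_derivative y t) (at t)" and lim: "(u \<longlongrightarrow> l) at_bot"
    and w: "\<And>t. (y has_real_derivative (- c * y t - r t)) (at t)" and r: "(r \<longlongrightarrow> 0) at_bot"
  shows "(y \<longlongrightarrow> 0) at_bot"
proof -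
  have bt: "((\<lambda>t. v (- t)) \<longlongrightarrow> a) at_top \<longleftrightarrow> (v \<longlongrightarrow> a) at_bot" for v :: "real \<Rightarrow> real" and a
    by (simp add: filterlim_at_bot_mirror)
  have "((\<lambda>t. - y (- t)) \<longlongrightarrow> 0) at_top"
  proof (rule derivative_vanishes_at_top[where u = "\<lambda>t. u (- t)" and c = "- c" and r = "\<lambda>t. r (- t)" and l = l])
    show "((\<lambda>t. u (- t)) has_real_derivative - y (- t)) (at t)" for t
      by (rule DERIV_mirror_minus[OF u])
    show "((\<lambda>t. - y (- t)) has_real_derivative - (- c) * - y (- t) - r (- t)) (at t)" for t
      by (rule DERIV_cong[OF DERIV_minus[OF DERIV_mirror_minus[OF w, of t]]]) simp
  qed (use lim r in \<open>simp_all only: bt\<close>)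
  then have "((\<lambda>t. y (- t)) \<longlongrightarrow> 0) at_top"
    using tendsto_minus_cancel_left[of "\<lambda>t. y (- t)" 0 at_top] by simp
  then show ?thesis by (simp only: bt)
qed

section \<open>The singular first-order equation\<close>

text \<open>Replacing \<open>h\<close> by \<open>h + \<eta>\<close> removes the singularity of \<open>p' = k + h / p\<close> at \<open>p = 0\<close>;
  \<open>\<kappa> (h + \<eta>)\<close> is a subsolution, uniformly in \<open>\<eta>\<close>.\<close>

lemma singular_ode_regularised:
  fixes h h' k :: "real \<Rightarrow> real"
  assumes a: "0 < a" and eta: "0 < \<eta>" and lam: "0 < \<kappa>" "\<kappa> * B + K \<le> 1 / \<kappa>"
    and h: "\<And>x. (h has_real_derivative h' x) (at x)" and h0: "h 0 = 0"
    and hn: "\<And>x. x \<in> {0..a} \<Longrightarrow> 0 \<le> h x" and B: "\<And>x. x \<in> {0..a} \<Longrightarrow> h' x \<le> B"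
    and k: "continuous_on {0..a} k" and K: "\<And>x. x \<in> {0..a} \<Longrightarrow> \<bar>k x\<bar> \<le> K"
  obtains p where "continuous_on {0..a} p" "p 0 = \<kappa> * \<eta>"
    "\<And>x. x \<in> {0..a} \<Longrightarrow> \<kappa> * (h x + \<eta>) \<le> p x"
    "\<And>x. 0 < x \<Longrightarrow> x < a \<Longrightarrow> (p has_real_derivative k x + (h x + \<eta>) / p x) (at x)"
proof -
  have hc: "continuous_on X h" for X
    using h by (intro DERIV_continuous_on) (auto intro: has_field_derivative_at_within)
  define m where "m = \<kappa> * \<eta>"
  have m: "0 < m" using eta lam by (simp add: m_def)
  \<comment> \<open>Truncating the denominator at the initial value \<open>m\<close> makes the
    right-hand side globally Lipschitz. The barrier \<open>\<kappa> * (h + \<eta>)\<close> is at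
    least \<open>m\<close>, so the truncation turns out to be inactive.\<close>
  define F where "F t x = k t + (h t + \<eta>) / max x m" for t x
  obtain M where M0: "0 < M" and M: "\<And>t. t \<in> {0..a} \<Longrightarrow> \<bar>h t\<bar> \<le> M"
    using continuous_on_Icc_abs_bound[OF hc] by blast
  define Kl where "Kl = (M + \<eta>) / m\<^sup>2"
  have Fc: "continuous_on {0..a} (\<lambda>t. F t (w t))" if "continuous_on {0..a} w" for w
    unfolding F_def using m by (intro continuous_intros k hc that) auto
  have Fl: "\<bar>F t x - F t y\<bar> \<le> Kl * \<bar>x - y\<bar>" if t: "t \<in> {0..a}" for t x y
  proof -
    have "F t x - F t y = (h t + \<eta>) * (max y m - max x m) / (max x m * max y m)"
      using m by (simp add: F_def field_simps max_def)
    then have "\<bar>F t x - F t y\<bar> = (h t + \<eta>) * \<bar>max y m - max x m\<bar> / (max x m * max y m)"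
      using m hn[OF t] eta by (simp add: abs_mult)
    also have "\<dots> \<le> (M + \<eta>) * \<bar>x - y\<bar> / (m * m)"
      using M[OF t] m hn[OF t] eta M0 by (intro frac_le mult_mono mult_pos_pos) (auto simp: max_def)
    finally show ?thesis
      by (simp add: Kl_def power2_eq_square)
  qed
  have Kl: "0 < Kl" using M0 eta m by (simp add: Kl_def)
  obtain p where pc: "continuous_on {0..a} p"
    and pint: "\<And>u. u \<in> {0..a} \<Longrightarrow> p u = m + integral {0..u} (\<lambda>t. F t (p t))"
    using picard_lindelof_on_interval[OF a Kl Fc Fl, of m] by blast
  have der: "(p has_real_derivative F x (p x)) (at x)" if x: "0 < x" "x < a" for x
  proof -
    have "((\<lambda>u. m + integral {0..u} (\<lambda>t. F t (p t))) has_real_derivative F x (p x)) (at x within {0..a})"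
      using integral_has_real_derivative[OF Fc[OF pc], of x] x
      by (auto intro!: derivative_eq_intros)
    then have "(p has_real_derivative F x (p x)) (at x within {0..a})"
      by (rule has_field_derivative_transform_within[where d = 1]) (use x pint in auto)
    then show ?thesis
      using x by (simp add: at_within_Icc_at)
  qed
  have p0: "p 0 = m" using pint[of 0] a by simp
  have lower: "0 \<le> p x - \<kappa> * (h x + \<eta>)" if "x \<in> {0..a}" for x
  proof (rule nonneg_by_barrier[where d = "\<lambda>x. p x - \<kappa> * (h x + \<eta>)", OF _ _ _ that])
    show "continuous_on {0..a} (\<lambda>x. p x - \<kappa> * (h x + \<eta>))"
      by (intro continuous_intros pc hc)
    show "0 \<le> p 0 - \<kappa> * (h 0 + \<eta>)" by (simp add: p0 h0 m_def)
    \<comment> \<open>Below the barrier the quotient is at least \<open>1 / \<kappa>\<close>; by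
      \<open>\<kappa> * B + K \<le> 1 / \<kappa>\<close> the solution then rises at least as fast as
      the barrier.\<close>
    fix x assume x: "0 < x" "x < a" and neg: "p x - \<kappa> * (h x + \<eta>) < 0"
    have H: "0 < h x + \<eta>" using hn[of x] x eta by auto
    have "m \<le> \<kappa> * (h x + \<eta>)"
      using hn[of x] x lam by (auto simp: m_def)
    then have "max (p x) m \<le> \<kappa> * (h x + \<eta>)" using neg by simp
    then have "(h x + \<eta>) / (\<kappa> * (h x + \<eta>)) \<le> (h x + \<eta>) / max (p x) m"
      using H m lam by (intro divide_left_mono mult_pos_pos) auto
    then have 1: "1 / \<kappa> \<le> (h x + \<eta>) / max (p x) m"
      using H by simp
    have 2: "\<kappa> * h' x \<le> \<kappa> * B" "- K \<le> k x"
      using B[of x] K[of x] x lam by (auto intro!: mult_left_mono)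
    have "((\<lambda>x. p x - \<kappa> * (h x + \<eta>)) has_real_derivative F x (p x) - \<kappa> * h' x) (at x)"
      by (auto intro!: derivative_eq_intros der[OF x] h)
    moreover have "0 \<le> F x (p x) - \<kappa> * h' x"
      unfolding F_def using 1 2 lam by linarith
    ultimately show "\<exists>y. ((\<lambda>x. p x - \<kappa> * (h x + \<eta>)) has_real_derivative y) (at x) \<and> 0 \<le> y"
      by blast
  qed
  show ?thesis
  proof
    show "continuous_on {0..a} p" by fact
    show "p 0 = \<kappa> * \<eta>" by (simp add: p0 m_def)
    show "\<kappa> * (h x + \<eta>) \<le> p x" if "x \<in> {0..a}" for x using lower[OF that] by simp
    show "(p has_real_derivative k x + (h x + \<eta>) / p x) (at x)" if x: "0 < x" "x < a" for x
    proof -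
      have "m \<le> \<kappa> * (h x + \<eta>)"
        using hn[of x] x lam by (auto simp: m_def)
      with lower[of x] x have "max (p x) m = p x" by simp
      then show ?thesis using der[OF x] by (simp add: F_def)
    qed
  qed
qed


text \<open>Equation and sign are imposed only in the open interval: in the applications the
  quotient is 0 / 0 at the start, and at \<open>a\<close> the height may be zero.\<close>

definition half_orbit ::
    "real \<Rightarrow> (real \<Rightarrow> real) \<Rightarrow> (real \<Rightarrow> real) \<Rightarrow> (real \<Rightarrow> real) \<Rightarrow> bool" where
  "half_orbit a h k p \<longleftrightarrow> continuous_on {0..a} p \<and> p 0 = 0 \<and>
     (\<forall>x. 0 < x \<longrightarrow> x < a \<longrightarrow> 0 < p x \<and> (p has_real_derivative k x + h x / p x) (at x))"

text \<open>As \<open>h \<ge> 0\<close>, the right-hand side \<open>k + h / p\<close> decreases in \<open>p\<close>: the singular equation is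
  order preserving and Lipschitz in \<open>k\<close>, with constants that do not see the singularity.\<close>

lemma half_orbit_le:
  assumes 1: "half_orbit a h k1 p1" and 2: "half_orbit a h k2 p2" and d: "0 \<le> \<delta>"
    and k: "\<And>x. 0 < x \<Longrightarrow> x < a \<Longrightarrow> k1 x \<le> k2 x + \<delta>"
    and h: "\<And>x. 0 < x \<Longrightarrow> x < a \<Longrightarrow> 0 \<le> h x"
    and x: "x \<in> {0..a}"
  shows "p1 x \<le> p2 x + \<delta> * x"
proof -
  have "0 \<le> p2 x + \<delta> * x - p1 x"
  proof (rule nonneg_by_barrier[where d = "\<lambda>x. p2 x + \<delta> * x - p1 x", OF _ _ _ x])
    show "continuous_on {0..a} (\<lambda>x. p2 x + \<delta> * x - p1 x)"
      using 1 2 by (auto simp: half_orbit_def intro!: continuous_intros)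
    show "0 \<le> p2 0 + \<delta> * 0 - p1 0"
      using 1 2 by (auto simp: half_orbit_def)
    fix y assume y: "0 < y" "y < a" and neg: "p2 y + \<delta> * y - p1 y < 0"
    have p: "0 < p1 y" "0 < p2 y" "(p1 has_real_derivative k1 y + h y / p1 y) (at y)"
      "(p2 has_real_derivative k2 y + h y / p2 y) (at y)"
      using 1 2 y by (auto simp: half_orbit_def)
    have "p2 y \<le> p1 y" using neg d y by (smt (verit) mult_nonneg_nonneg)
    then have "h y / p1 y \<le> h y / p2 y"
      using p h[OF y] by (intro divide_left_mono) auto
    moreover have "((\<lambda>x. p2 x + \<delta> * x - p1 x) has_real_derivative
        (k2 y + h y / p2 y + \<delta> - (k1 y + h y / p1 y))) (at y)"
      by (auto intro!: derivative_eq_intros p)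
    ultimately show "\<exists>z. ((\<lambda>x. p2 x + \<delta> * x - p1 x) has_real_derivative z) (at y) \<and> 0 \<le> z"
      using k[OF y] by (intro exI conjI) auto
  qed
  then show ?thesis by simp
qed

text \<open>The regularised solutions decrease as \<eta> tends to 0 and share the Lipschitz constant
  \<open>K + 1 / \<kappa>\<close>, since the barrier bounds the quotient by
  \<open>1 / \<kappa>\<close>; the barrier also keeps the limit positive inside. The upper bound
  later gives fronts an infinite lifetime, the lower one their exponential decay.\<close>

lemma half_orbit_exists:
  fixes h h' k :: "real \<Rightarrow> real"
  assumes a: "0 < a" and lam: "0 < \<kappa>" "\<kappa> * B + K \<le> 1 / \<kappa>"
    and h: "\<And>x. (h has_real_derivative h' x) (at x)" and h0: "h 0 = 0" and ha: "0 \<le> h a"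
    and hp: "\<And>x. 0 < x \<Longrightarrow> x < a \<Longrightarrow> 0 < h x" and B: "\<And>x. x \<in> {0..a} \<Longrightarrow> h' x \<le> B"
    and k: "continuous_on {0..a} k" and K: "\<And>x. x \<in> {0..a} \<Longrightarrow> \<bar>k x\<bar> \<le> K"
  obtains p where "half_orbit a h k p"
    "\<And>x. x \<in> {0..a} \<Longrightarrow> \<kappa> * h x \<le> p x"
    "\<And>x. x \<in> {0..a} \<Longrightarrow> p x \<le> (K + 1 / \<kappa>) * x"
proof -
  have hn: "0 \<le> h x" if "x \<in> {0..a}" for x
    using hp[of x] h0 ha that by (cases "x = 0 \<or> x = a") auto
  have hc: "continuous_on X h" for X
    using h by (intro DERIV_continuous_on) (auto intro: has_field_derivative_at_within)
  define \<eta> where "\<eta> n = 1 / (real n + 1)" for n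
  have eta: "0 < \<eta> n" for n by (simp add: \<eta>_def)
  have eta_lim: "\<eta> \<longlonglongrightarrow> 0"
    unfolding \<eta>_def using LIMSEQ_inverse_real_of_nat by (simp add: inverse_eq_divide add.commute)
  have "\<exists>p. continuous_on {0..a} p \<and> p 0 = \<kappa> * \<eta> n \<and>
      (\<forall>x\<in>{0..a}. \<kappa> * (h x + \<eta> n) \<le> p x) \<and>
      (\<forall>x. 0 < x \<longrightarrow> x < a \<longrightarrow> (p has_real_derivative k x + (h x + \<eta> n) / p x) (at x))" for n
    by (rule singular_ode_regularised[OF a eta[of n] lam h h0 hn B k K]) blast+
  then obtain p where pc: "\<And>n. continuous_on {0..a} (p n)" and p0: "\<And>n. p n 0 = \<kappa> * \<eta> n"
    and low: "\<And>n x. x \<in> {0..a} \<Longrightarrow> \<kappa> * (h x + \<eta> n) \<le> p n x"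
    and der: "\<And>n x. 0 < x \<Longrightarrow> x < a \<Longrightarrow> (p n has_real_derivative k x + (h x + \<eta> n) / p n x) (at x)"
    by metis
  define C where "C = K + 1 / \<kappa>"
  have K0: "0 \<le> K" using K[of 0] a by auto
  have C0: "0 < C" using lam K0 by (simp add: C_def add_nonneg_pos)
  have pos: "0 < p n x" if "x \<in> {0..a}" for n x
    using low[OF that, of n] hn[OF that] eta[of n] lam
    by (smt (verit) mult_pos_pos)
  have quot: "0 \<le> (h x + \<eta> n) / p n x" "(h x + \<eta> n) / p n x \<le> 1 / \<kappa>" if "x \<in> {0..a}" for n x
    using pos[OF that, of n] low[OF that, of n] hn[OF that] eta[of n] lam
    by (auto simp: field_simps)
  have rhs: "\<bar>k x + (h x + \<eta> n) / p n x\<bar> \<le> C" if "x \<in> {0..a}" for n x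
    using quot[OF that, of n] K[OF that] by (auto simp: C_def)
  have lipp: "\<bar>p n y - p n x\<bar> \<le> C * (y - x)" if "x \<in> {0..a}" "y \<in> {0..a}" "x \<le> y" for n x y
  proof (cases "x = y")
    case False
    then have "x < y" using that by simp
    moreover have "continuous_on {x..y} (p n)"
      by (rule continuous_on_subset[OF pc]) (use that in auto)
    moreover have "p n differentiable at z" if "x < z" "z < y" for z
      using der[of z n] that \<open>x \<in> {0..a}\<close> \<open>y \<in> {0..a}\<close> by (auto simp: real_differentiable_def)
    ultimately obtain l z where z: "x < z" "z < y" "DERIV (p n) z :> l" "p n y - p n x = (y - x) * l"
      using MVT[of x y "p n"] by blast
    then have "l = k z + (h z + \<eta> n) / p n z"
      using der[of z n] that DERIV_unique by auto
    then have "\<bar>l\<bar> \<le> C" using rhs[of z n] z that by auto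
    then show ?thesis
      using z \<open>x < y\<close> by (simp add: abs_mult mult.commute[of C] mult_left_mono)
  qed simp
  have mono: "p m x \<le> p n x" if nm: "n \<le> m" and x: "x \<in> {0..a}" for n m x
  proof -
    have em: "\<eta> m \<le> \<eta> n" using nm by (simp add: \<eta>_def frac_le)
    have "0 \<le> p n x - p m x"
    proof (rule nonneg_by_barrier[where d = "\<lambda>x. p n x - p m x", OF _ _ _ x])
      show "continuous_on {0..a} (\<lambda>x. p n x - p m x)"
        by (intro continuous_intros pc)
      show "0 \<le> p n 0 - p m 0" using em lam by (simp add: p0)
      fix y assume y: "0 < y" "y < a" and neg: "p n y - p m y < 0"
      \<comment> \<open>Were \<open>p m\<close> above \<open>p n\<close>, then \<open>p n\<close>
        would have the larger numerator and the smaller denominator, hence the larger slope.\<close>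
      have "(h y + \<eta> m) / p m y \<le> (h y + \<eta> n) / p n y"
        using neg em hn[of y] pos[of y] y eta[of n] by (intro frac_le) auto
      moreover have "((\<lambda>x. p n x - p m x) has_real_derivative
          (k y + (h y + \<eta> n) / p n y - (k y + (h y + \<eta> m) / p m y))) (at y)"
        by (intro derivative_intros der y)
      ultimately show "\<exists>z. ((\<lambda>x. p n x - p m x) has_real_derivative z) (at y) \<and> 0 \<le> z"
        by (intro exI conjI) auto
    qed
    then show ?thesis by simp
  qed
  define q where "q x = lim (\<lambda>n. p n x)" for x
  have lim: "(\<lambda>n. p n x) \<longlonglongrightarrow> q x" if "x \<in> {0..a}" for x
  proof -
    have "decseq (\<lambda>n. p n x)" using mono[OF _ that] by (auto simp: decseq_def)
    moreover have "\<forall>n. 0 \<le> p n x" using pos[OF that] by (auto intro: less_imp_le)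
    ultimately have "convergent (\<lambda>n. p n x)"
      using decseq_convergent convergentI by metis
    then show ?thesis
      unfolding q_def by (simp add: convergent_LIMSEQ_iff)
  qed
  have q0: "q 0 = 0"
  proof (rule LIMSEQ_unique[OF lim])
    show "(\<lambda>n. p n 0) \<longlonglongrightarrow> 0"
      unfolding p0 using tendsto_mult[OF tendsto_const eta_lim, of \<kappa>] by simp
  qed (use a in auto)
  have qlow: "\<kappa> * h x \<le> q x" if "x \<in> {0..a}" for x
  proof (rule LIMSEQ_le_const[OF lim[OF that]])
    have "\<kappa> * h x \<le> p n x" for n
      using low[OF that, of n] lam eta[of n] by (smt (verit) mult_left_mono)
    then show "\<exists>N. \<forall>n\<ge>N. \<kappa> * h x \<le> p n x" by blast
  qed
  have qlip: "\<bar>q y - q x\<bar> \<le> C * (y - x)" if "x \<in> {0..a}" "y \<in> {0..a}" "x \<le> y" for x y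
  proof (rule LIMSEQ_le_const2)
    show "(\<lambda>n. \<bar>p n y - p n x\<bar>) \<longlonglongrightarrow> \<bar>q y - q x\<bar>"
      by (intro tendsto_intros lim that)
  qed (use lipp[OF that] in blast)
  have qc: "continuous_on {0..a} q"
  proof (rule continuous_on_subset[of "{0..a}"])
    have "C-lipschitz_on {0..a} q"
    proof (rule lipschitz_onI)
      fix x y assume "x \<in> {0..a}" "y \<in> {0..a}"
      then show "dist (q x) (q y) \<le> C * dist x y"
        using qlip[of x y] qlip[of y x] by (cases "x \<le> y") (auto simp: dist_real_def abs_minus_commute)
    qed (use C0 in simp)
    then show "continuous_on {0..a} q" by (rule lipschitz_on_continuous_on)
  qed simp
  have qpos: "0 < q x" if "0 < x" "x < a" for x
    using qlow[of x] hp[OF that] that lam by (smt (verit) mult_pos_pos atLeastAtMost_iff)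
  have qder: "(q has_real_derivative k x + h x / q x) (at x)" if x: "0 < x" "x < a" for x
  proof -
    \<comment> \<open>The limit is taken in the integrated equation on an interval inside
      \<open>(0, a)\<close>, where \<open>q\<close> is positive and the integrands are dominated by
      the constant \<open>C\<close>.\<close>
    define l r where "l = x / 2" and "r = (x + a) / 2"
    have lr: "0 < l" "l < x" "x < r" "r < a" using x by (auto simp: l_def r_def)
    define R where "R t = k t + h t / q t" for t
    have Rc: "continuous_on {l..r} R"
      unfolding R_def using lr qpos
      by (intro continuous_intros hc continuous_on_subset[OF k] continuous_on_subset[OF qc])
        (auto simp: less_imp_neq[THEN not_sym])
    have eq: "q l + integral {l..y} R = q y" if y: "y \<in> {l..r}" for y
    proof -
      have hi: "((\<lambda>t. k t + (h t + \<eta> n) / p n t) has_integral (p n y - p n l)) {l..y}" for n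
      proof (rule fundamental_theorem_of_calculus)
        fix t assume "t \<in> {l..y}"
        then have "0 < t" "t < a" using y lr by auto
        then show "(p n has_vector_derivative k t + (h t + \<eta> n) / p n t) (at t within {l..y})"
          unfolding has_real_derivative_iff_has_vector_derivative[symmetric]
          by (intro has_field_derivative_at_within[OF der])
      qed (use y in auto)
      have "(R has_integral (q y - q l)) {l..y}"
      proof (rule has_integral_dominated_convergence[OF hi])
        show "(\<lambda>t. C) integrable_on {l..y}" by (intro integrable_continuous_real continuous_intros)
        show "\<forall>t\<in>{l..y}. norm (k t + (h t + \<eta> n) / p n t) \<le> C" for n
          using rhs y lr by auto
        show "\<forall>t\<in>{l..y}. (\<lambda>n. k t + (h t + \<eta> n) / p n t) \<longlonglongrightarrow> R t"
        proof
          fix t assume t: "t \<in> {l..y}"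
          have "(\<lambda>n. k t + (h t + \<eta> n) / p n t) \<longlonglongrightarrow> k t + (h t + 0) / q t"
            using t y lr qpos[of t] by (intro tendsto_intros eta_lim lim) auto
          then show "(\<lambda>n. k t + (h t + \<eta> n) / p n t) \<longlonglongrightarrow> R t" by (simp add: R_def)
        qed
        show "(\<lambda>n. p n y - p n l) \<longlonglongrightarrow> q y - q l"
          using y lr by (intro tendsto_intros lim) auto
      qed
      then show ?thesis by (simp add: integral_unique)
    qed
    have "((\<lambda>y. q l + integral {l..y} R) has_real_derivative R x) (at x within {l..r})"
      using integral_has_real_derivative[OF Rc, of x] lr by (auto intro!: derivative_eq_intros)
    then have "(q has_real_derivative R x) (at x within {l..r})"
      by (rule has_field_derivative_transform_within[where d = 1]) (use lr eq in auto)
    then show ?thesis using lr by (simp add: at_within_Icc_at R_def)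
  qed
  show ?thesis
  proof
    show "half_orbit a h k q"
      using qc q0 qpos qder by (auto simp: half_orbit_def)
    show "\<kappa> * h x \<le> q x" if "x \<in> {0..a}" for x using qlow[OF that] .
    show "q x \<le> (K + 1 / \<kappa>) * x" if "x \<in> {0..a}" for x
      using qlip[of 0 x] that a q0 by (auto simp: C_def)
  qed
qed

section \<open>Uniqueness of the speed\<close>

text \<open>With \<open>D = 1 - c\<^sup>2\<tau>\<close>, \<open>s = c / \<surd>D\<close> and \<open>\<xi> = \<surd>D t\<close>, the profile system becomes
  \<open>u'' + s g(u) u' + f(u) = 0\<close> with \<open>g = 1 - \<tau> f'\<close>; the Allen--Cahn profile is the case \<open>g = 1\<close>.\<close>

definition normal_front ::
    "(real \<Rightarrow> real) \<Rightarrow> (real \<Rightarrow> real) \<Rightarrow> real \<Rightarrow> (real \<Rightarrow> real) \<Rightarrow> (real \<Rightarrow> real) \<Rightarrow> bool" where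
  "normal_front f g s u y \<longleftrightarrow>
     (\<forall>t. (u has_real_derivative y t) (at t)) \<and>
     (\<forall>t. (y has_real_derivative (- s * g (u t) * y t - f (u t))) (at t)) \<and>
     (u \<longlongrightarrow> 0) at_bot \<and> (u \<longlongrightarrow> 1) at_top \<and> (y \<longlongrightarrow> 0) at_bot \<and> (y \<longlongrightarrow> 0) at_top"

text \<open>A monotone front in the phase plane: \<open>p\<close> is \<open>u'\<close> as a function of \<open>u\<close>.\<close>

definition orbit ::
    "(real \<Rightarrow> real) \<Rightarrow> (real \<Rightarrow> real) \<Rightarrow> real \<Rightarrow> (real \<Rightarrow> real) \<Rightarrow> bool" where
  "orbit f g s p \<longleftrightarrow> continuous_on {0..1} p \<and> p 0 = 0 \<and> p 1 = 0 \<and>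
     (\<forall>x. 0 < x \<longrightarrow> x < 1 \<longrightarrow> 0 < p x \<and> (p has_real_derivative (- s * g x - f x / p x)) (at x))"

text \<open>The symmetry by which statements proved at the state 0, or for \<open>0 \<le> s\<close>,
  pass to the state 1, or to negative \<open>s\<close>.\<close>

lemma normal_front_reflect:
  assumes "normal_front f g s u y"
  shows "normal_front (\<lambda>x. - f (1 - x)) (reflect g) (- s) (\<lambda>t. 1 - u (- t)) (\<lambda>t. y (- t))"
  unfolding normal_front_def
proof (intro conjI allI)
  have u: "(u has_real_derivative y t) (at t)"
    and y: "(y has_real_derivative (- s * g (u t) * y t - f (u t))) (at t)" for t
    using assms by (auto simp: normal_front_def)
  show "((\<lambda>t. 1 - u (- t)) has_real_derivative y (- t)) (at t)" for t
    using DERIV_mirror_minus[OF u] by (auto intro!: derivative_eq_intros)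
  show "((\<lambda>t. y (- t)) has_real_derivative
      (- (- s) * g (1 - (1 - u (- t))) * y (- t) - - f (1 - (1 - u (- t))))) (at t)" for t
    using DERIV_mirror_minus[OF y, of t] by (simp add: add.commute)
  have lims: "(u \<longlongrightarrow> 0) at_bot" "(u \<longlongrightarrow> 1) at_top" "(y \<longlongrightarrow> 0) at_bot" "(y \<longlongrightarrow> 0) at_top"
    using assms by (auto simp: normal_front_def)
  have bt: "((\<lambda>t. w (- t)) \<longlongrightarrow> l) at_bot \<longleftrightarrow> (w \<longlongrightarrow> l) at_top" for w :: "real \<Rightarrow> real" and l
    by (simp add: filterlim_at_bot_mirror)
  have tb: "((\<lambda>t. w (- t)) \<longlongrightarrow> l) at_top \<longleftrightarrow> (w \<longlongrightarrow> l) at_bot" for w :: "real \<Rightarrow> real" and l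
    by (simp add: filterlim_at_bot_mirror)
  show "((\<lambda>t. y (- t)) \<longlongrightarrow> 0) at_bot" "((\<lambda>t. y (- t)) \<longlongrightarrow> 0) at_top"
    using lims by (simp_all only: bt tb)
  have "((\<lambda>t. u (- t)) \<longlongrightarrow> 1) at_bot" "((\<lambda>t. u (- t)) \<longlongrightarrow> 0) at_top"
    using lims by (simp_all only: bt tb)
  then show "((\<lambda>t. 1 - u (- t)) \<longlongrightarrow> 0) at_bot" "((\<lambda>t. 1 - u (- t)) \<longlongrightarrow> 1) at_top"
    by (auto intro!: tendsto_eq_intros)
qed

lemma orbit_reflect:
  assumes "orbit f g s p"
  shows "orbit (\<lambda>x. - f (1 - x)) (reflect g) (- s) (reflect p)"
  unfolding orbit_def
proof (intro conjI allI impI)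
  show "continuous_on {0..1} (reflect p)"
    by (rule continuous_on_compose2[of "{0..1}" p]) (use assms in \<open>auto simp: orbit_def intro!: continuous_intros\<close>)
  show "p (1 - 0) = 0" "p (1 - 1) = 0" using assms by (auto simp: orbit_def)
  fix x :: real assume x: "0 < x" "x < 1"
  then show "0 < p (1 - x)" using assms by (auto simp: orbit_def)
  have "(p has_real_derivative (- s * g (1 - x) - f (1 - x) / p (1 - x))) (at (1 - x))"
    using assms x by (auto simp: orbit_def)
  from DERIV_reflect[OF this]
  show "(reflect p has_real_derivative (- (- s) * g (1 - x) - - f (1 - x) / p (1 - x))) (at x)"
    by (simp add: add.commute)
qed

section \<open>Arbitrary fronts: range, monotonicity and speed\<close>

locale bistable_reaction =
  fixes f f' :: "real \<Rightarrow> real" and \<alpha> :: real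
  assumes alpha: "0 < \<alpha>" "\<alpha> < 1"
    and f_deriv: "\<And>x. (f has_real_derivative f' x) (at x)"
    and f'_cont: "continuous_on UNIV f'"
    and f_zeros: "f 0 = 0" "f \<alpha> = 0" "f 1 = 0"
    and f'_ends: "f' 0 < 0" "f' 1 < 0"
    and f_pos: "\<And>x. x < 0 \<Longrightarrow> 0 < f x" "\<And>x. \<alpha> < x \<Longrightarrow> x < 1 \<Longrightarrow> 0 < f x"
    and f_neg: "\<And>x. 0 < x \<Longrightarrow> x < \<alpha> \<Longrightarrow> f x < 0" "\<And>x. 1 < x \<Longrightarrow> f x < 0"
begin

text \<open>Having \<open>f'\<close> as a parameter of the locale lets the reflected reaction be
  interpreted with \<open>reflect f'\<close> instead of a term built from
  \<open>deriv\<close>.\<close>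

lemma reflect_bistable: "bistable_reaction (\<lambda>x. - f (1 - x)) (reflect f') (1 - \<alpha>)"
proof
  show "((\<lambda>x. - f (1 - x)) has_real_derivative f' (1 - x)) (at x)" for x
    using DERIV_minus[OF DERIV_reflect[OF f_deriv, of x]] by simp
  show "continuous_on UNIV (reflect f')"
    by (intro continuous_on_compose2[OF f'_cont] continuous_intros) auto
qed (use alpha f_zeros f'_ends f_pos f_neg in auto)

lemma f_cont: "continuous_on X f"
  using f_deriv by (intro DERIV_continuous_on) (auto intro: has_field_derivative_at_within)

lemma f_linear_bound:
  obtains M where "0 < M" "\<And>x. x \<in> {0..1} \<Longrightarrow> \<bar>f x\<bar> \<le> M * x"
proof -
  obtain M where M: "0 < M" "\<And>x. x \<in> {0..1} \<Longrightarrow> \<bar>f' x\<bar> \<le> M"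
    using continuous_on_Icc_abs_bound[OF continuous_on_subset[OF f'_cont, of "{0..1}"]] by blast
  have "\<bar>f x\<bar> \<le> M * x" if x: "x \<in> {0..1}" for x
  proof (cases "x = 0")
    case False
    then obtain z where "0 < z" "z < x" "f x - f 0 = (x - 0) * f' z"
      using MVT2[of 0 x f f'] f_deriv x by auto
    then show ?thesis
      using M(2)[of z] x by (simp add: f_zeros abs_mult mult.commute mult_right_mono)
  qed (simp add: f_zeros)
  with M(1) show ?thesis by (rule that)
qed

text \<open>Maximum principle: at a negative global minimum the derivative vanishes and the second
  derivative is \<open>- f u < 0\<close>, because \<open>f\<close> is positive on the negative axis;
  such a point is a strict maximum.\<close>

lemma normal_front_nonneg:
  assumes "normal_front f g s u y"
  shows "0 \<le> u t"
proof (rule ccontr)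
  assume neg: "\<not> 0 \<le> u t"
  have u: "(u has_real_derivative y t) (at t)"
    and y: "(y has_real_derivative (- s * g (u t) * y t - f (u t))) (at t)" for t
    using assms by (auto simp: normal_front_def)
  have uc: "continuous_on X u" for X
    using u by (intro DERIV_continuous_on) (auto intro: has_field_derivative_at_within)
  have lims: "(u \<longlongrightarrow> 0) at_bot" "(u \<longlongrightarrow> 1) at_top"
    using assms by (auto simp: normal_front_def)
  obtain A where A: "\<And>x. x \<le> A \<Longrightarrow> u t < u x"
    using order_tendstoD(1)[OF lims(1), of "u t"] neg by (auto simp: eventually_at_bot_linorder)
  obtain C where C: "\<And>x. C \<le> x \<Longrightarrow> u t < u x"
    using order_tendstoD(1)[OF lims(2), of "u t"] neg by (auto simp: eventually_at_top_linorder)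
  have AC: "A < t" "t < C" using A[of t] C[of t] by (auto simp: not_le[symmetric])
  then obtain m where m: "m \<in> {A..C}" "\<And>x. x \<in> {A..C} \<Longrightarrow> u m \<le> u x"
    using continuous_attains_inf[of "{A..C}" u] uc by auto
  have mt: "u m \<le> u t" using m(2)[of t] AC by auto
  have min: "u m \<le> u x" for x
    using m(2)[of x] A[of x] C[of x] mt by (cases "x \<le> A"; cases "C \<le> x") auto
  have "y m = 0"
    using DERIV_local_min[OF u, of 1 m] min by auto
  then have "(y has_real_derivative (- f (u m))) (at m)" using y[of m] by simp
  moreover have "- f (u m) < 0" using f_pos(1)[of "u m"] mt neg by simp
  ultimately obtain e where "0 < e" "\<And>h. 0 < h \<Longrightarrow> h < e \<Longrightarrow> u (m + h) < u m"
    using strict_local_max_second_derivative[OF u _ \<open>y m = 0\<close>] by metis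
  from this(2)[of "e / 2"] this(1) min[of "m + e / 2"] show False by simp
qed

lemma normal_front_le_1:
  assumes "normal_front f g s u y"
  shows "u t \<le> 1"
proof -
  interpret R: bistable_reaction "\<lambda>x. - f (1 - x)" "reflect f'" "1 - \<alpha>"
    by (rule reflect_bistable)
  from R.normal_front_nonneg[OF normal_front_reflect[OF assms], of "- t"]
  show ?thesis by simp
qed

text \<open>A zero of \<open>u\<close> is a minimum, so the front would sit at the rest state
  \<open>(0, 0)\<close>. Gronwall for \<open>u^2 + y^2\<close> then keeps it there for all later
  times, against the limit 1.\<close>

lemma normal_front_pos:
  assumes g_cont: "continuous_on UNIV g" and nf: "normal_front f g s u y"
  shows "0 < u t"
proof (rule ccontr)
  have u: "(u has_real_derivative y t) (at t)"
    and y: "(y has_real_derivative (- s * g (u t) * y t - f (u t))) (at t)" for t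
    using nf by (auto simp: normal_front_def)
  note range = normal_front_nonneg[OF nf] normal_front_le_1[OF nf]
  assume "\<not> 0 < u t"
  then have u0: "u t = 0" using range(1)[of t] by simp
  have y0: "y t = 0"
    using DERIV_local_min[OF u, of 1 t] range(1) u0 by auto
  obtain M where M: "0 < M" "\<And>x. x \<in> {0..1} \<Longrightarrow> \<bar>f x\<bar> \<le> M * x"
    using f_linear_bound by blast
  obtain G where G: "0 < G" "\<And>x. x \<in> {0..1} \<Longrightarrow> \<bar>g x\<bar> \<le> G"
    using continuous_on_Icc_abs_bound[OF continuous_on_subset[OF g_cont, of "{0..1}"]] by blast
  \<comment> \<open>The three terms bound the contributions to \<open>N'\<close> of
    \<open>2 * u * y\<close>, of \<open>f\<close> through
    \<open>\<bar>f u\<bar> \<le> M * u\<close>, and of the damping.\<close>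
  define K where "K = 1 + M + 2 * \<bar>s\<bar> * G"
  define N where "N x = (u x)\<^sup>2 + (y x)\<^sup>2" for x
  define N' where "N' x = 2 * u x * y x + 2 * y x * (- s * g (u x) * y x - f (u x))" for x
  have N': "(N has_real_derivative N' x) (at x)" for x
    unfolding N_def N'_def by (auto intro!: derivative_eq_intros u y)
  have bound: "N' x \<le> K * N x" for x
  proof -
    have 1: "2 * u x * y x \<le> N x"
      unfolding N_def by (rule sum_squares_bound)
    have "\<bar>y x\<bar> * \<bar>f (u x)\<bar> \<le> \<bar>y x\<bar> * (M * u x)"
      by (intro mult_left_mono M) (use range[of x] in auto)
    moreover have "- (2 * (y x * f (u x))) \<le> 2 * (\<bar>y x\<bar> * \<bar>f (u x)\<bar>)"
      by (simp flip: abs_mult)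
    moreover have "2 * (\<bar>y x\<bar> * (M * u x)) \<le> M * N x"
    proof -
      have "2 * u x * \<bar>y x\<bar> \<le> N x"
        unfolding N_def using sum_squares_bound[of "u x" "\<bar>y x\<bar>"] by simp
      then have "M * (2 * u x * \<bar>y x\<bar>) \<le> M * N x" using M(1) by simp
      then show ?thesis by (simp add: mult_ac)
    qed
    ultimately have 2: "- (2 * (y x * f (u x))) \<le> M * N x" by linarith
    have "- s * g (u x) \<le> \<bar>s\<bar> * G"
      using G(2)[of "u x"] range[of x] abs_mult[of s "g (u x)"] mult_left_mono[of "\<bar>g (u x)\<bar>" G "\<bar>s\<bar>"]
      by auto
    then have "- s * g (u x) * (y x)\<^sup>2 \<le> \<bar>s\<bar> * G * (y x)\<^sup>2"
      by (intro mult_right_mono) auto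
    also have "\<dots> \<le> \<bar>s\<bar> * G * N x"
      unfolding N_def using G(1) by (intro mult_left_mono) auto
    finally have 3: "- s * g (u x) * (y x)\<^sup>2 \<le> \<bar>s\<bar> * G * N x" .
    have "N' x = 2 * u x * y x + 2 * (- s * g (u x) * (y x)\<^sup>2) - 2 * (y x * f (u x))"
      by (simp add: N'_def algebra_simps power2_eq_square)
    also have "\<dots> \<le> N x + 2 * (\<bar>s\<bar> * G * N x) + M * N x"
      using 1 2 3 by linarith
    finally show ?thesis by (simp add: K_def algebra_simps)
  qed
  have "u x = 0" if "t \<le> x" for x
  proof -
    have "exp (- K * x) * N x \<le> exp (- K * t) * N t"
    proof (rule DERIV_nonpos_imp_nonincreasing[where f = "\<lambda>x. exp (- K * x) * N x", OF that])
      fix z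
      have "((\<lambda>x. exp (- K * x) * N x) has_real_derivative exp (- K * z) * (N' z - K * N z)) (at z)"
        by (auto intro!: derivative_eq_intros N' simp: algebra_simps)
      moreover have "exp (- K * z) * (N' z - K * N z) \<le> 0"
        using bound[of z] by (intro mult_nonneg_nonpos) auto
      ultimately show "\<exists>l. ((\<lambda>x. exp (- K * x) * N x) has_real_derivative l) (at z) \<and> l \<le> 0"
        by blast
    qed
    then have "exp (- K * x) * N x \<le> 0" by (simp add: N_def u0 y0)
    then have "N x \<le> 0" by (simp add: mult_le_0_iff not_le)
    then show ?thesis
      unfolding N_def by (smt (verit) zero_le_power2 power2_eq_iff_nonneg zero_eq_power2)
  qed
  then have "eventually (\<lambda>x. u x = 0) at_top"
    by (auto simp: eventually_at_top_linorder)
  then have "(u \<longlongrightarrow> 0) at_top"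
    by (rule tendsto_eventually)
  moreover have "(u \<longlongrightarrow> 1) at_top" using nf by (simp add: normal_front_def)
  ultimately show False
    using tendsto_unique[of "at_top :: real filter" u 0 1] by simp
qed

lemma normal_front_less_1:
  assumes g_cont: "continuous_on UNIV g" and nf: "normal_front f g s u y"
  shows "u t < 1"
proof -
  interpret R: bistable_reaction "\<lambda>x. - f (1 - x)" "reflect f'" "1 - \<alpha>"
    by (rule reflect_bistable)
  have "continuous_on UNIV (reflect g)"
    by (intro continuous_on_compose2[OF g_cont] continuous_intros) auto
  from R.normal_front_pos[OF this normal_front_reflect[OF nf], of "- t"]
  show ?thesis by simp
qed

text \<open>The energy \<open>u'\<^sup>2 / 2 + F(u)\<close> with \<open>F' = f\<close> is nonincreasing and tends to \<open>F(1)\<close>, so critical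
  values of \<open>u\<close> lie below \<open>\<alpha>\<close>, where every critical point is a strict minimum.\<close>

lemma normal_front_increasing_aux:
  assumes g_cont: "continuous_on UNIV g" and g_pos: "\<And>x. x \<in> {0..1} \<Longrightarrow> 0 < g x"
    and nf: "normal_front f g s u y" and s: "0 \<le> s"
  shows "0 < y t"
proof (rule ccontr)
  assume neg: "\<not> 0 < y t"
  have u: "(u has_real_derivative y t) (at t)"
    and y: "(y has_real_derivative (- s * g (u t) * y t - f (u t))) (at t)" for t
    using nf by (auto simp: normal_front_def)
  have uc: "continuous_on X u" for X
    using u by (intro DERIV_continuous_on) (auto intro: has_field_derivative_at_within)
  have lims: "(u \<longlongrightarrow> 0) at_bot" "(u \<longlongrightarrow> 1) at_top" "(y \<longlongrightarrow> 0) at_bot" "(y \<longlongrightarrow> 0) at_top"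
    using nf by (auto simp: normal_front_def)
  note range = normal_front_pos[OF g_cont nf] normal_front_less_1[OF g_cont nf]
  have "\<exists>F. \<forall>x. -\<infinity> < ereal x \<longrightarrow> ereal x < \<infinity> \<longrightarrow> (F has_vector_derivative f x) (at x)"
    by (rule einterval_antiderivative)
      (use f_deriv in \<open>auto intro: DERIV_isCont\<close>)
  then obtain F where F: "\<And>x. (F has_real_derivative f x) (at x)"
    by (auto simp: has_real_derivative_iff_has_vector_derivative)
  have Fc: "isCont F x" for x
    using F by (rule DERIV_isCont)
  define E where "E t = (y t)\<^sup>2 / 2 + F (u t)" for t
  have E': "(E has_real_derivative (- s * g (u t) * (y t)\<^sup>2)) (at t)" for t
    unfolding E_def
    by (auto intro!: derivative_eq_intros u y DERIV_chain2[OF F] simp: power2_eq_square field_simps)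
  have E_anti: "E b \<le> E a" if "a \<le> b" for a b
  proof (rule DERIV_nonpos_imp_nonincreasing[where f = E, OF that])
    fix x
    have "0 \<le> s * (g (u x) * (y x)\<^sup>2)"
      using s g_pos[of "u x"] range[of x] by (intro mult_nonneg_nonneg) auto
    then have "- s * g (u x) * (y x)\<^sup>2 \<le> 0" by (simp add: mult.assoc)
    with E'[of x] show "\<exists>l. (E has_real_derivative l) (at x) \<and> l \<le> 0" by blast
  qed
  have "(E \<longlongrightarrow> 0\<^sup>2 / 2 + F 1) at_top"
    unfolding E_def by (intro tendsto_intros lims isCont_tendsto_compose[OF Fc]) auto
  then have E_lim: "(E \<longlongrightarrow> F 1) at_top" by simp
  have E_ge: "F 1 \<le> E t" for t
    by (rule tendsto_upperbound[OF E_lim])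
      (auto simp: eventually_at_top_linorder intro!: exI[of _ t] E_anti)
  have crit: "u x < \<alpha>" if "y x = 0" for x
  proof (rule ccontr)
    assume "\<not> u x < \<alpha>"
    then have "\<exists>l. (F has_real_derivative l) (at z) \<and> 0 < l" if "u x < z" "z < 1" for z
      using F[of z] f_pos(2)[of z] that by auto
    then have "F (u x) < F 1"
      using range[of x] Fc
      by (intro DERIV_pos_imp_increasing_open[of "u x" 1 F] continuous_at_imp_continuous_on) auto
    with E_ge[of x] that show False by (simp add: E_def)
  qed
  \<comment> \<open>The maximum over the half-line up to \<open>t\<close> is a critical point: clear
    if \<open>m < t\<close>, and if \<open>m = t\<close> a negative slope would give larger values
    just before \<open>t\<close>.\<close>
  obtain m where m: "m \<le> t" "\<And>x. x \<le> t \<Longrightarrow> u x \<le> u m"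
    using at_bot_limit_attains_max[OF uc lims(1) range(1)] by blast
  have ym: "y m = 0"
  proof (cases "m < t")
    case True
    then show ?thesis
      using DERIV_local_max[OF u, of "t - m" m] m(2) by auto
  next
    case False
    then have mt: "m = t" using m by simp
    show ?thesis
    proof (rule ccontr)
      assume "y m \<noteq> 0"
      then have "y m < 0" using neg mt by simp
      then obtain d where "0 < d" "\<forall>h>0. h < d \<longrightarrow> u m < u (m - h)"
        using DERIV_neg_dec_left[OF u] by blast
      then have "u m < u (m - d / 2)" by simp
      with m(2)[of "m - d / 2"] mt \<open>0 < d\<close> show False by simp
    qed
  qed
  have neg_f: "f (u m) < 0"
    using crit[OF ym] range(1)[of m] f_neg(1) by simp
  have u_neg: "((\<lambda>t. - u t) has_real_derivative - y t) (at t)" for t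
    by (auto intro!: derivative_eq_intros u)
  have y_neg: "((\<lambda>t. - y t) has_real_derivative f (u m)) (at m)"
    using y[of m] ym by (auto intro!: derivative_eq_intros)
  have ym_neg: "- y m = 0" using ym by simp
  obtain e where "0 < e" "\<And>h. 0 < h \<Longrightarrow> h < e \<Longrightarrow> - u (m + h) < - u m"
      "\<And>h. 0 < h \<Longrightarrow> h < e \<Longrightarrow> - u (m - h) < - u m"
    by (rule strict_local_max_second_derivative[OF u_neg y_neg ym_neg neg_f]) (rule that)
  from this(3)[of "e / 2"] this(1) m(2)[of "m - e / 2"] m(1) show False by simp
qed

lemma normal_front_increasing:
  assumes g_cont: "continuous_on UNIV g" and g_pos: "\<And>x. x \<in> {0..1} \<Longrightarrow> 0 < g x"
    and nf: "normal_front f g s u y"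
  shows "0 < y t"
proof (cases "0 \<le> s")
  case True
  then show ?thesis using normal_front_increasing_aux[OF assms] by blast
next
  case False
  interpret R: bistable_reaction "\<lambda>x. - f (1 - x)" "reflect f'" "1 - \<alpha>"
    by (rule reflect_bistable)
  have "continuous_on UNIV (reflect g)"
    by (intro continuous_on_compose2[OF g_cont] continuous_intros) auto
  from R.normal_front_increasing_aux[OF this _ normal_front_reflect[OF nf], of "- t"] g_pos False
  show ?thesis by simp
qed

text \<open>Along the front, \<open>d = u' - p(u)\<close> satisfies
  \<open>d' = - (s\<^sub>1 - s\<^sub>2) g(u) u' + f(u) d / p(u)\<close>. The sign of \<open>f\<close> makes \<open>d \<le> 0\<close> before and \<open>d \<ge> 0\<close>
  after \<open>u\<close> reaches \<open>\<alpha>\<close> if \<open>s\<^sub>1 > s\<^sub>2\<close>, which contradicts \<open>d' < 0\<close> at that point.\<close>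

lemma front_speed_le_orbit_speed:
  assumes g_cont: "continuous_on UNIV g" and g_pos: "\<And>x. x \<in> {0..1} \<Longrightarrow> 0 < g x"
    and nf: "normal_front f g s1 u y" and orb: "orbit f g s2 p"
  shows "s1 \<le> s2"
proof (rule ccontr)
  assume "\<not> s1 \<le> s2"
  then have s: "0 < s1 - s2" by simp
  have u: "(u has_real_derivative y t) (at t)"
    and y: "(y has_real_derivative (- s1 * g (u t) * y t - f (u t))) (at t)" for t
    using nf by (auto simp: normal_front_def)
  have lims: "(u \<longlongrightarrow> 0) at_bot" "(u \<longlongrightarrow> 1) at_top" "(y \<longlongrightarrow> 0) at_bot" "(y \<longlongrightarrow> 0) at_top"
    using nf by (auto simp: normal_front_def)
  note range = normal_front_pos[OF g_cont nf] normal_front_less_1[OF g_cont nf]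
  note ypos = normal_front_increasing[OF g_cont g_pos nf]
  have p: "0 < p x" "(p has_real_derivative (- s2 * g x - f x / p x)) (at x)" if "0 < x" "x < 1" for x
    using orb that by (auto simp: orbit_def)
  have pc: "continuous_on {0..1} p" and p01: "p 0 = 0" "p 1 = 0" using orb by (auto simp: orbit_def)
  define d where "d t = y t - p (u t)" for t
  define d' where "d' t = - ((s1 - s2) * g (u t) * y t) + f (u t) * (d t / p (u t))" for t
  have d': "(d has_real_derivative d' t) (at t)" for t
  proof -
    have "(d has_real_derivative
        (- s1 * g (u t) * y t - f (u t) - (- s2 * g (u t) - f (u t) / p (u t)) * y t)) (at t)"
      unfolding d_def by (intro derivative_intros y DERIV_chain2[OF p(2) u] range)
    also have "(- s1 * g (u t) * y t - f (u t) - (- s2 * g (u t) - f (u t) / p (u t)) * y t) = d' t"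
      using p(1)[OF range, of t] by (simp add: d'_def d_def field_simps)
    finally show ?thesis .
  qed
  have dc: "continuous_on X d" for X
    using d' by (intro DERIV_continuous_on) (auto intro: has_field_derivative_at_within)
  have damp: "0 < (s1 - s2) * g (u t) * y t" for t
    using s g_pos[of "u t"] range[of t] ypos[of t] by (intro mult_pos_pos) auto
  have pu: "((\<lambda>t. p (u t)) \<longlongrightarrow> p l) F" if "(u \<longlongrightarrow> l) F" "l \<in> {0..1}" for l F
    by (rule continuous_on_tendsto_compose[OF pc that])
      (use range in \<open>auto intro!: always_eventually intro: less_imp_le\<close>)
  have dlim: "(d \<longlongrightarrow> 0) at_bot" "(d \<longlongrightarrow> 0) at_top"
    unfolding d_def using tendsto_diff[OF lims(3) pu[OF lims(1)]] tendsto_diff[OF lims(4) pu[OF lims(2)]]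
    by (auto simp: p01)
  have umono: "u a < u b" if "a < b" for a b
    using that u ypos by (intro DERIV_pos_imp_increasing[where f = u]) auto
  obtain b where b: "u b = \<alpha>"
  proof -
    obtain l where l: "u l < \<alpha>"
      using order_tendstoD(2)[OF lims(1) alpha(1)] by (auto simp: eventually_at_bot_linorder)
    obtain r where r: "\<alpha> < u r"
      using order_tendstoD(1)[OF lims(2) alpha(2)] by (auto simp: eventually_at_top_linorder)
    have "l \<le> r" using umono[of r l] l r by force
    then show ?thesis
      using IVT[of u l \<alpha> r] l r u that by (auto intro: DERIV_isCont)
  qed
  \<comment> \<open>The boundary value 0 of \<open>d\<close> is reached only at infinity, so the
    barrier starts at a finite time with a margin \<epsilon>. Before \<open>b\<close> the reaction
    is nonpositive, and \<open>d\<close> decreases wherever it exceeds \<epsilon>.\<close>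
  have left: "d t \<le> \<epsilon>" if t: "t \<le> b" and eps: "0 < \<epsilon>" for t \<epsilon>
  proof -
    obtain A where A: "\<And>x. x \<le> A \<Longrightarrow> d x < \<epsilon>"
      using order_tendstoD(2)[OF dlim(1) eps] by (auto simp: eventually_at_bot_linorder)
    define a where "a = min A t"
    have "0 \<le> \<epsilon> - d t"
    proof (rule nonneg_by_barrier[where d = "\<lambda>x. \<epsilon> - d x" and a = a and b = b])
      show "continuous_on {a..b} (\<lambda>x. \<epsilon> - d x)" by (intro continuous_intros dc)
      show "0 \<le> \<epsilon> - d a" using A[of a] by (simp add: a_def)
      show "t \<in> {a..b}" using t by (simp add: a_def)
      fix x assume x: "a < x" "x < b" "\<epsilon> - d x < 0"
      have "f (u x) \<le> 0" using umono[OF x(2)] b f_neg(1)[of "u x"] range(1)[of x] by simp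
      moreover have "0 \<le> d x / p (u x)" using x eps p(1)[OF range, of x] by simp
      ultimately have "f (u x) * (d x / p (u x)) \<le> 0" by (rule mult_nonpos_nonneg)
      then have "d' x \<le> 0" using damp[of x] unfolding d'_def by linarith
      then show "\<exists>l. ((\<lambda>x. \<epsilon> - d x) has_real_derivative l) (at x) \<and> 0 \<le> l"
        by (intro exI[of _ "- d' x"]) (auto intro!: derivative_eq_intros d')
    qed
    then show ?thesis by simp
  qed
  have right: "- \<epsilon> \<le> d t" if t: "b \<le> t" and eps: "0 < \<epsilon>" for t \<epsilon>
  proof -
    obtain A where A: "\<And>x. A \<le> x \<Longrightarrow> - \<epsilon> < d x"
      using order_tendstoD(1)[OF dlim(2), of "- \<epsilon>"] eps by (auto simp: eventually_at_top_linorder)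
    define a where "a = max A t"
    \<comment> \<open>The barrier argument starts where smallness is known, here at the right end,
      hence the reversal of time.\<close>
    have "0 \<le> \<epsilon> + d (- (- t))"
    proof (rule nonneg_by_barrier[where d = "\<lambda>x. \<epsilon> + d (- x)" and a = "- a" and b = "- b"])
      show "continuous_on {- a..- b} (\<lambda>x. \<epsilon> + d (- x))"
        by (intro continuous_intros continuous_on_compose2[OF dc]) auto
      show "0 \<le> \<epsilon> + d (- (- a))" using A[of a] by (simp add: a_def)
      show "- t \<in> {- a..- b}" using t by (simp add: a_def)
      fix x assume x: "- a < x" "x < - b" "\<epsilon> + d (- x) < 0"
      have "0 \<le> f (u (- x))"
        using umono[of b "- x"] x b f_pos(2)[of "u (- x)"] range(2)[of "- x"] by simp
      moreover have "d (- x) / p (u (- x)) \<le> 0"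
        using x eps p(1)[OF range, of "- x"] by (intro divide_nonpos_pos) auto
      ultimately have "f (u (- x)) * (d (- x) / p (u (- x))) \<le> 0" by (rule mult_nonneg_nonpos)
      then have "d' (- x) \<le> 0" using damp[of "- x"] unfolding d'_def by linarith
      then show "\<exists>l. ((\<lambda>x. \<epsilon> + d (- x)) has_real_derivative l) (at x) \<and> 0 \<le> l"
        by (intro exI[of _ "- d' (- x)"]) (auto intro!: derivative_eq_intros DERIV_mirror_minus d')
    qed
    then show ?thesis by simp
  qed
  have dle: "d t \<le> 0" if "t \<le> b" for t
    using left[OF that] by (rule field_le_epsilon) simp
  have "0 \<le> d b"
    using right[of b] field_le_epsilon[of 0 "d b"] by force
  then have db: "d b = 0" using dle[of b] by simp
  have "d' b < 0"
    using damp[of b] unfolding d'_def db by simp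
  then obtain e where "0 < e" "\<forall>h>0. h < e \<longrightarrow> d b < d (b - h)"
    using DERIV_neg_dec_left[OF d'] by blast
  then have "d b < d (b - e / 2)" "0 < e" by auto
  with dle[of "b - e / 2"] db show False by simp
qed

text \<open>Reflection negates both speeds, so the same one-sided comparison gives the opposite
  inequality.\<close>

lemma front_speed_eq_orbit_speed:
  assumes g_cont: "continuous_on UNIV g" and g_pos: "\<And>x. x \<in> {0..1} \<Longrightarrow> 0 < g x"
    and nf: "normal_front f g s1 u y" and orb: "orbit f g s2 p"
  shows "s1 = s2"
proof (rule antisym)
  interpret R: bistable_reaction "\<lambda>x. - f (1 - x)" "reflect f'" "1 - \<alpha>"
    by (rule reflect_bistable)
  have "continuous_on UNIV (reflect g)"
    by (intro continuous_on_compose2[OF g_cont] continuous_intros) auto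
  from R.front_speed_le_orbit_speed[OF this _ normal_front_reflect[OF nf] orbit_reflect[OF orb]] g_pos
  show "s2 \<le> s1" by simp
qed (rule front_speed_le_orbit_speed[OF assms])

end

section \<open>Existence and continuity of the speed\<close>

lemma normal_front_of_orbit:
  assumes orb: "orbit f g s p" and C: "0 < C"
    "\<And>x. x \<in> {0..1} \<Longrightarrow> p x \<le> C * x" "\<And>x. x \<in> {0..1} \<Longrightarrow> p x \<le> C * (1 - x)"
  obtains u where "normal_front f g s u (\<lambda>t. p (u t))" "\<And>t. 0 < u t" "\<And>t. u t < 1"
proof -
  have p: "0 < p x" "(p has_real_derivative (- s * g x - f x / p x)) (at x)" if "0 < x" "x < 1" for x
    using orb that by (auto simp: orbit_def)
  have pc: "continuous_on {0..1} p" and p01: "p 0 = 0" "p 1 = 0" using orb by (auto simp: orbit_def)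
  obtain u where u: "\<And>t. 0 < u t" "\<And>t. u t < 1" "\<And>t. (u has_real_derivative p (u t)) (at t)"
    "(u \<longlongrightarrow> 0) at_bot" "(u \<longlongrightarrow> 1) at_top"
  proof (rule autonomous_connection[of p C])
    fix x :: real assume x: "0 < x" "x < 1"
    show "0 < p x" "isCont p x" using p[OF x] by (auto intro: DERIV_isCont)
    show "p x \<le> C * x" "p x \<le> C * (1 - x)" using C(2,3)[of x] x by auto
  next
    show "0 < C" by fact
  next
    fix u
    assume "\<And>t. 0 < u t" "\<And>t. u t < 1" "\<And>t. (u has_real_derivative p (u t)) (at t)"
      "(u \<longlongrightarrow> 0) at_bot" "(u \<longlongrightarrow> 1) at_top"
    then show thesis by (rule that)
  qed
  have pu: "((\<lambda>t. p (u t)) \<longlongrightarrow> p l) F" if "(u \<longlongrightarrow> l) F" "l \<in> {0..1}" for l F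
    by (rule continuous_on_tendsto_compose[OF pc that])
      (use u(1,2) in \<open>auto intro!: always_eventually intro: less_imp_le\<close>)
  have "((\<lambda>t. p (u t)) has_real_derivative (- s * g (u t) * p (u t) - f (u t))) (at t)" for t
  proof -
    have "((\<lambda>t. p (u t)) has_real_derivative (- s * g (u t) - f (u t) / p (u t)) * p (u t)) (at t)"
      by (intro DERIV_chain2[OF p(2)] u)
    then show ?thesis using p(1)[OF u(1,2), of t] by (simp add: algebra_simps)
  qed
  then have "normal_front f g s u (\<lambda>t. p (u t))"
    using u pu[OF u(4)] pu[OF u(5)] p01 by (simp add: normal_front_def)
  then show ?thesis using u(1,2) by (rule that)
qed

text \<open>\<open>exit_value\<close> is the height at which the orbit leaving \<open>0\<close> crosses \<open>u = \<alpha>\<close>; after reflection it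
  is the height at which the orbit entering \<open>1\<close> does. Fronts are the zeros of the mismatch.\<close>

definition exit_value :: "(real \<Rightarrow> real) \<Rightarrow> real \<Rightarrow> (real \<Rightarrow> real) \<Rightarrow> real \<Rightarrow> real" where
  "exit_value f \<alpha> g s = (SOME v. \<exists>p. half_orbit \<alpha> (\<lambda>x. - f x) (\<lambda>x. - s * g x) p \<and> v = p \<alpha>)"

definition mismatch :: "(real \<Rightarrow> real) \<Rightarrow> real \<Rightarrow> (real \<Rightarrow> real) \<Rightarrow> real \<Rightarrow> real" where
  "mismatch f \<alpha> g s =
     exit_value f \<alpha> g s - exit_value (\<lambda>x. - f (1 - x)) (1 - \<alpha>) (reflect g) (- s)"

lemma mismatch_reflect:
  "mismatch (\<lambda>x. - f (1 - x)) (1 - \<alpha>) (reflect g) (- s) = - mismatch f \<alpha> g s"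
  by (simp add: mismatch_def)

context bistable_reaction
begin

lemma left_orbit_exists:
  assumes g_cont: "continuous_on UNIV g"
  obtains \<kappa> C p where "0 < \<kappa>" "0 < C" "half_orbit \<alpha> (\<lambda>x. - f x) (\<lambda>x. - s * g x) p"
    "\<And>x. x \<in> {0..\<alpha>} \<Longrightarrow> \<kappa> * - f x \<le> p x" "\<And>x. x \<in> {0..\<alpha>} \<Longrightarrow> p x \<le> C * x"
proof -
  obtain B where B: "0 < B" "\<And>x. x \<in> {0..\<alpha>} \<Longrightarrow> \<bar>f' x\<bar> \<le> B"
    using continuous_on_Icc_abs_bound[OF continuous_on_subset[OF f'_cont, of "{0..\<alpha>}"]] by blast
  have kc: "continuous_on {0..\<alpha>} (\<lambda>x. - s * g x)"
    by (intro continuous_intros continuous_on_subset[OF g_cont]) auto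
  obtain K where K: "0 < K" "\<And>x. x \<in> {0..\<alpha>} \<Longrightarrow> \<bar>- s * g x\<bar> \<le> K"
    using continuous_on_Icc_abs_bound[OF kc] by blast
  \<comment> \<open>With \<open>1 / \<kappa> = 1 + B + K\<close> one has
    \<open>\<kappa> * B \<le> 1\<close>, and the barrier condition becomes
    \<open>1 + K \<le> 1 + B + K\<close>.\<close>
  define \<kappa> where "\<kappa> = 1 / (1 + B + K)"
  have lam: "0 < \<kappa>" using B K by (simp add: \<kappa>_def)
  have "\<kappa> * B \<le> 1" using B K by (simp add: \<kappa>_def)
  then have lam2: "\<kappa> * B + K \<le> 1 / \<kappa>" using B by (simp add: \<kappa>_def)
  obtain p where p: "half_orbit \<alpha> (\<lambda>x. - f x) (\<lambda>x. - s * g x) p"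
    "\<And>x. x \<in> {0..\<alpha>} \<Longrightarrow> \<kappa> * - f x \<le> p x" "\<And>x. x \<in> {0..\<alpha>} \<Longrightarrow> p x \<le> (K + 1 / \<kappa>) * x"
  proof (rule half_orbit_exists[OF alpha(1) lam lam2, where h = "\<lambda>x. - f x" and h' = "\<lambda>x. - f' x"
        and k = "\<lambda>x. - s * g x"])
    show "((\<lambda>x. - f x) has_real_derivative - f' x) (at x)" for x
      by (intro derivative_intros f_deriv)
    show "- f' x \<le> B" if "x \<in> {0..\<alpha>}" for x using B(2)[OF that] by auto
    show "0 < - f x" if "0 < x" "x < \<alpha>" for x using f_neg(1)[OF that] by simp
  qed (use f_zeros kc K in auto)
  show ?thesis
    by (rule that[OF lam _ p]) (use K lam in \<open>auto intro: add_pos_pos\<close>)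
qed

text \<open>Comparison with \<delta> = 0 in both directions: the orbit leaving the singular point 0
  is unique, so the choice in \<open>exit_value\<close> is forced.\<close>

lemma exit_value_eq:
  assumes p: "half_orbit \<alpha> (\<lambda>x. - f x) (\<lambda>x. - s * g x) p"
  shows "exit_value f \<alpha> g s = p \<alpha>"
  unfolding exit_value_def
proof (rule some_equality)
  show "\<exists>q. half_orbit \<alpha> (\<lambda>x. - f x) (\<lambda>x. - s * g x) q \<and> p \<alpha> = q \<alpha>" using p by blast
  fix v assume "\<exists>q. half_orbit \<alpha> (\<lambda>x. - f x) (\<lambda>x. - s * g x) q \<and> v = q \<alpha>"
  then obtain q where q: "half_orbit \<alpha> (\<lambda>x. - f x) (\<lambda>x. - s * g x) q" "v = q \<alpha>" by blast
  have n: "0 \<le> - f x" if "0 < x" "x < \<alpha>" for x using f_neg(1)[OF that] by simp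
  show "v = p \<alpha>"
    using half_orbit_le[OF p q(1), of 0 \<alpha>] half_orbit_le[OF q(1) p, of 0 \<alpha>] n q(2) alpha by force
qed

text \<open>One comparison for two purposes: \<delta> = 0 yields monotonicity in \<open>s\<close>,
  positive \<delta> yields continuity in \<open>s\<close> and in the damping.\<close>

lemma exit_value_le:
  assumes g: "continuous_on UNIV g1" "continuous_on UNIV g2" and d: "0 \<le> \<delta>"
    and le: "\<And>x. x \<in> {0..1} \<Longrightarrow> s2 * g2 x \<le> s1 * g1 x + \<delta>"
  shows "exit_value f \<alpha> g1 s1 \<le> exit_value f \<alpha> g2 s2 + \<delta>"
proof -
  obtain p1 where p1: "half_orbit \<alpha> (\<lambda>x. - f x) (\<lambda>x. - s1 * g1 x) p1"
    by (rule left_orbit_exists[OF g(1)])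
  obtain p2 where p2: "half_orbit \<alpha> (\<lambda>x. - f x) (\<lambda>x. - s2 * g2 x) p2"
    by (rule left_orbit_exists[OF g(2)])
  have "p1 \<alpha> \<le> p2 \<alpha> + \<delta> * \<alpha>"
  proof (rule half_orbit_le[OF p1 p2 d])
    fix x assume x: "0 < x" "x < \<alpha>"
    then show "- s1 * g1 x \<le> - s2 * g2 x + \<delta>" using le[of x] alpha by simp
    show "0 \<le> - f x" using f_neg(1)[OF x] by simp
  qed (use alpha in auto)
  also have "\<delta> * \<alpha> \<le> \<delta>" using d alpha by (simp add: mult_left_le)
  finally show ?thesis by (simp add: exit_value_eq[OF p1] exit_value_eq[OF p2])
qed

context
  fixes g :: "real \<Rightarrow> real"
  assumes g_cont: "continuous_on UNIV g"
    and g_pos: "\<And>x. x \<in> {0..1} \<Longrightarrow> 0 < g x"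
begin

lemma exit_value_antimono: "s1 \<le> s2 \<Longrightarrow> exit_value f \<alpha> g s2 \<le> exit_value f \<alpha> g s1"
  using exit_value_le[OF g_cont g_cont, of 0 s1 s2] g_pos by (force intro: mult_right_mono less_imp_le)

text \<open>A \<open>half_orbit\<close> may have height zero at its end. For
  \<open>s \<le> 0\<close> the damping accelerates, both terms of the slope help, and
  \<open>p\<close> strictly increases up to \<alpha>.\<close>

lemma exit_value_pos:
  assumes s: "s \<le> 0"
  shows "0 < exit_value f \<alpha> g s"
proof -
  obtain p where p: "half_orbit \<alpha> (\<lambda>x. - f x) (\<lambda>x. - s * g x) p"
    by (rule left_orbit_exists[OF g_cont])
  have "p (\<alpha> / 2) < p \<alpha>"
  proof (rule DERIV_pos_imp_increasing_open[where f = p])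
    fix x assume x: "\<alpha> / 2 < x" "x < \<alpha>"
    then have "(p has_real_derivative (- s * g x + - f x / p x)) (at x)" "0 < p x"
      using p alpha by (auto simp: half_orbit_def)
    moreover have "0 \<le> - s * g x"
      using s g_pos[of x] x alpha by (intro mult_nonneg_nonneg) auto
    moreover have "0 < - f x / p x"
      using f_neg(1)[of x] x alpha \<open>0 < p x\<close> by (intro divide_pos_pos) auto
    ultimately show "\<exists>y. (p has_real_derivative y) (at x) \<and> 0 < y"
      by (intro exI[of _ "- s * g x + - f x / p x"]) auto
  next
    have "continuous_on {0..\<alpha>} p" using p by (simp add: half_orbit_def)
    then show "continuous_on {\<alpha> / 2..\<alpha>} p"
      by (rule continuous_on_subset) (use alpha in auto)
  qed (use alpha in auto)
  moreover have "0 < p (\<alpha> / 2)" using p alpha by (simp add: half_orbit_def)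
  ultimately show ?thesis by (simp add: exit_value_eq[OF p])
qed

text \<open>Dropping the positive term \<open>- f / p\<close> leaves a slope of at least
  \<open>- s * \<gamma>\<close>. The resulting linear growth in \<open>- s\<close> makes the
  mismatch change sign.\<close>

lemma exit_value_ge:
  assumes s: "s \<le> 0" and low: "\<And>x. x \<in> {0..1} \<Longrightarrow> \<gamma> \<le> g x"
  shows "- s * \<gamma> * \<alpha> \<le> exit_value f \<alpha> g s"
proof -
  obtain p where p: "half_orbit \<alpha> (\<lambda>x. - f x) (\<lambda>x. - s * g x) p"
    by (rule left_orbit_exists[OF g_cont])
  have "p 0 + s * \<gamma> * 0 \<le> p \<alpha> + s * \<gamma> * \<alpha>"
  proof (rule DERIV_nonneg_imp_increasing_open[where f = "\<lambda>x. p x + s * \<gamma> * x"])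
    fix x assume x: "0 < x" "x < \<alpha>"
    then have px: "(p has_real_derivative (- s * g x + - f x / p x)) (at x)" "0 < p x"
      using p by (auto simp: half_orbit_def)
    have "- s * \<gamma> \<le> - s * g x"
      using s low[of x] x alpha by (intro mult_left_mono) auto
    moreover have "0 < - f x / p x"
      using f_neg(1)[of x] x px by (intro divide_pos_pos) auto
    ultimately have "0 \<le> - s * g x + - f x / p x + s * \<gamma>" by linarith
    moreover have "((\<lambda>x. p x + s * \<gamma> * x) has_real_derivative - s * g x + - f x / p x + s * \<gamma>) (at x)"
      by (auto intro!: derivative_eq_intros px(1))
    ultimately show "\<exists>y. ((\<lambda>x. p x + s * \<gamma> * x) has_real_derivative y) (at x) \<and> 0 \<le> y"
      by blast
  next
    have "continuous_on {0..\<alpha>} p" using p by (simp add: half_orbit_def)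
    then show "continuous_on {0..\<alpha>} (\<lambda>x. p x + s * \<gamma> * x)"
      by (intro continuous_intros)
  qed (use alpha in auto)
  then show ?thesis using p by (simp add: exit_value_eq[OF p] half_orbit_def)
qed

lemma reflect_g: "continuous_on UNIV (reflect g)" "\<And>x. x \<in> {0..1} \<Longrightarrow> 0 < reflect g x"
  by (auto intro!: continuous_on_compose2[OF g_cont] continuous_intros g_pos)

lemma mismatch_antimono:
  assumes "s1 \<le> s2"
  shows "mismatch f \<alpha> g s2 \<le> mismatch f \<alpha> g s1"
proof -
  interpret R: bistable_reaction "\<lambda>x. - f (1 - x)" "reflect f'" "1 - \<alpha>"
    by (rule reflect_bistable)
  show ?thesis
    using exit_value_antimono[OF assms] R.exit_value_antimono[OF reflect_g, of "- s2" "- s1"] assms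
    by (simp add: mismatch_def)
qed

lemma mismatch_nonneg_somewhere: "\<exists>s\<le>0. 0 \<le> mismatch f \<alpha> g s"
proof -
  interpret R: bistable_reaction "\<lambda>x. - f (1 - x)" "reflect f'" "1 - \<alpha>"
    by (rule reflect_bistable)
  obtain m where m: "m \<in> {0..1}" "\<And>x. x \<in> {0..1} \<Longrightarrow> g m \<le> g x"
    using continuous_attains_inf[of "{0..1}" g] continuous_on_subset[OF g_cont] by auto
  have gm: "0 < g m * \<alpha>" using g_pos[OF m(1)] alpha by simp
  define q where "q = exit_value (\<lambda>x. - f (1 - x)) (1 - \<alpha>) (reflect g) 0"
  have q: "0 < q" unfolding q_def by (rule R.exit_value_pos[OF reflect_g]) simp_all
  \<comment> \<open>Chosen so that the lower bound \<open>- s * g m * \<alpha>\<close> equals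
    \<open>q\<close>, the reflected exit height at speed 0, which bounds the reflected height at
    \<open>- s\<close>.\<close>
  define s where "s = - (q / (g m * \<alpha>))"
  have s: "s \<le> 0" using q gm by (simp add: s_def)
  have "exit_value (\<lambda>x. - f (1 - x)) (1 - \<alpha>) (reflect g) (- s) \<le> q"
    unfolding q_def by (rule R.exit_value_antimono[OF reflect_g]) (use s in simp_all)
  moreover have "q \<le> exit_value f \<alpha> g s"
  proof -
    have "- s * g m * \<alpha> = q" using g_pos[OF m(1)] alpha by (simp add: s_def)
    then show ?thesis using exit_value_ge[OF s m(2)] by simp
  qed
  ultimately show ?thesis using s by (auto simp: mismatch_def)
qed

end

text \<open>Only the product of \<open>s\<close> and \<open>g\<close> matters: equal dampings give
  continuity in \<open>s\<close> for the intermediate value theorem, equal speeds give continuity in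
  \<tau>.\<close>

lemma mismatch_lipschitz:
  assumes g: "continuous_on UNIV g1" "continuous_on UNIV g2" and d: "0 \<le> \<delta>"
    and le: "\<And>x. x \<in> {0..1} \<Longrightarrow> \<bar>s1 * g1 x - s2 * g2 x\<bar> \<le> \<delta>"
  shows "\<bar>mismatch f \<alpha> g1 s1 - mismatch f \<alpha> g2 s2\<bar> \<le> 2 * \<delta>"
proof -
  interpret R: bistable_reaction "\<lambda>x. - f (1 - x)" "reflect f'" "1 - \<alpha>"
    by (rule reflect_bistable)
  have r: "continuous_on UNIV (reflect g1)" "continuous_on UNIV (reflect g2)"
    by (auto intro!: continuous_on_compose2[OF g(1)] continuous_on_compose2[OF g(2)] continuous_intros)
  have le': "s2 * g2 x \<le> s1 * g1 x + \<delta>" "s1 * g1 x \<le> s2 * g2 x + \<delta>" if "x \<in> {0..1}" for x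
    using le[OF that] by auto
  have "exit_value f \<alpha> g1 s1 \<le> exit_value f \<alpha> g2 s2 + \<delta>" "exit_value f \<alpha> g2 s2 \<le> exit_value f \<alpha> g1 s1 + \<delta>"
    using exit_value_le[OF g d le'(1)] exit_value_le[OF g(2,1) d le'(2)] by auto
  moreover have "exit_value (\<lambda>x. - f (1 - x)) (1 - \<alpha>) (reflect g1) (- s1)
      \<le> exit_value (\<lambda>x. - f (1 - x)) (1 - \<alpha>) (reflect g2) (- s2) + \<delta>"
    by (rule R.exit_value_le[OF r d]) (use le'(2)[of "1 - x" for x] in force)
  moreover have "exit_value (\<lambda>x. - f (1 - x)) (1 - \<alpha>) (reflect g2) (- s2)
      \<le> exit_value (\<lambda>x. - f (1 - x)) (1 - \<alpha>) (reflect g1) (- s1) + \<delta>"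
    by (rule R.exit_value_le[OF r(2,1) d]) (use le'(1)[of "1 - x" for x] in force)
  ultimately show ?thesis by (auto simp: mismatch_def abs_le_iff)
qed

context
  fixes g :: "real \<Rightarrow> real"
  assumes g_cont: "continuous_on UNIV g"
    and g_pos: "\<And>x. x \<in> {0..1} \<Longrightarrow> 0 < g x"
begin

lemma mismatch_root_exists: "\<exists>s. mismatch f \<alpha> g s = 0"
proof -
  interpret R: bistable_reaction "\<lambda>x. - f (1 - x)" "reflect f'" "1 - \<alpha>"
    by (rule reflect_bistable)
  obtain a where a: "a \<le> 0" "0 \<le> mismatch f \<alpha> g a"
    using mismatch_nonneg_somewhere[OF g_cont g_pos] by blast
  obtain b where b: "b \<le> 0" "0 \<le> mismatch (\<lambda>x. - f (1 - x)) (1 - \<alpha>) (reflect g) b"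
    using R.mismatch_nonneg_somewhere[OF reflect_g[OF g_cont g_pos]] by auto
  have b': "mismatch f \<alpha> g (- b) \<le> 0"
    using b(2) mismatch_reflect[of f \<alpha> g "- b"] by simp
  obtain G where G: "0 < G" "\<And>x. x \<in> {0..1} \<Longrightarrow> \<bar>g x\<bar> \<le> G"
    using continuous_on_Icc_abs_bound[OF continuous_on_subset[OF g_cont, of "{0..1}"]] by blast
  have "(2 * G)-lipschitz_on UNIV (mismatch f \<alpha> g)"
  proof (rule lipschitz_onI)
    fix s1 s2 :: real
    have "\<bar>mismatch f \<alpha> g s1 - mismatch f \<alpha> g s2\<bar> \<le> 2 * (G * \<bar>s1 - s2\<bar>)"
    proof (rule mismatch_lipschitz[OF g_cont g_cont])
      fix x :: real assume "x \<in> {0..1}"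
      then have "\<bar>g x\<bar> * \<bar>s1 - s2\<bar> \<le> G * \<bar>s1 - s2\<bar>" using G by (intro mult_right_mono) auto
      then show "\<bar>s1 * g x - s2 * g x\<bar> \<le> G * \<bar>s1 - s2\<bar>"
        by (simp add: abs_mult mult.commute flip: left_diff_distrib)
    qed (use G in simp)
    then show "dist (mismatch f \<alpha> g s1) (mismatch f \<alpha> g s2) \<le> 2 * G * dist s1 s2"
      by (simp add: dist_real_def)
  qed (use G in simp)
  then have cont: "continuous_on UNIV (mismatch f \<alpha> g)"
    by (rule lipschitz_on_continuous_on)
  have "\<exists>x\<ge>a. x \<le> - b \<and> mismatch f \<alpha> g x = 0"
    by (rule IVT2'[of "mismatch f \<alpha> g" "- b" 0 a, OF b' a(2)]) (use a b cont in \<open>auto intro: continuous_on_subset\<close>)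
  then show ?thesis by blast
qed

text \<open>Equal heights make the glued function continuous at \<alpha>. As both branches obey the
  same equation with a right-hand side continuous there, it is differentiable as well. The bounds
  are exported for the time parametrisation and the decay rates.\<close>

lemma orbit_of_mismatch_root:
  assumes root: "mismatch f \<alpha> g s = 0"
  obtains \<kappa> C p where "0 < \<kappa>" "0 < C" "orbit f g s p"
    "\<And>x. x \<in> {0..1} \<Longrightarrow> p x \<le> C * x" "\<And>x. x \<in> {0..1} \<Longrightarrow> p x \<le> C * (1 - x)"
    "\<And>x. x \<in> {0..\<alpha>} \<Longrightarrow> \<kappa> * - f x \<le> p x" "\<And>x. x \<in> {\<alpha>..1} \<Longrightarrow> \<kappa> * f x \<le> p x"
proof -
  interpret R: bistable_reaction "\<lambda>x. - f (1 - x)" "reflect f'" "1 - \<alpha>"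
    by (rule reflect_bistable)
  have rg: "continuous_on UNIV (reflect g)" "\<And>x. x \<in> {0..1} \<Longrightarrow> 0 < reflect g x"
    using reflect_g[OF g_cont g_pos] by auto
  obtain \<kappa>1 C1 p1 where 1: "0 < \<kappa>1" "0 < C1" "half_orbit \<alpha> (\<lambda>x. - f x) (\<lambda>x. - s * g x) p1"
    "\<And>x. x \<in> {0..\<alpha>} \<Longrightarrow> \<kappa>1 * - f x \<le> p1 x" "\<And>x. x \<in> {0..\<alpha>} \<Longrightarrow> p1 x \<le> C1 * x"
    by (rule left_orbit_exists[OF g_cont]) (rule that)
  obtain \<kappa>2 C2 p2 where 2: "0 < \<kappa>2" "0 < C2"
    "half_orbit (1 - \<alpha>) (\<lambda>x. - (- f (1 - x))) (\<lambda>x. - (- s) * reflect g x) p2"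
    "\<And>x. x \<in> {0..1 - \<alpha>} \<Longrightarrow> \<kappa>2 * - (- f (1 - x)) \<le> p2 x" "\<And>x. x \<in> {0..1 - \<alpha>} \<Longrightarrow> p2 x \<le> C2 * x"
    by (rule R.left_orbit_exists[OF rg(1), where s = "- s"]) (rule that)
  have e1: "exit_value f \<alpha> g s = p1 \<alpha>" by (rule exit_value_eq[OF 1(3)])
  have e2: "exit_value (\<lambda>x. - f (1 - x)) (1 - \<alpha>) (reflect g) (- s) = p2 (1 - \<alpha>)"
    by (rule R.exit_value_eq[OF 2(3)])
  have match: "p1 \<alpha> = p2 (1 - \<alpha>)" using root e1 e2 by (simp add: mismatch_def)
  \<comment> \<open>For either sign of \<open>s\<close> one of the two orbits is in its accelerating
    case, and the heights agree, so gluing happens away from the axis.\<close>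
  have pa: "0 < p1 \<alpha>"
  proof (cases "s \<le> 0")
    case True
    then show ?thesis using exit_value_pos[OF g_cont g_pos, of s] e1 by simp
  next
    case False
    then show ?thesis using R.exit_value_pos[OF rg, of "- s"] e2 match by simp
  qed
  define p where "p x = (if x \<le> \<alpha> then p1 x else p2 (1 - x))" for x
  define R where "R x = - s * g x - f x / p x" for x
  have c1: "continuous_on {0..\<alpha>} p1" and c2: "continuous_on {0..1 - \<alpha>} p2"
    and z: "p1 0 = 0" "p2 0 = 0" using 1 2 by (auto simp: half_orbit_def)
  have "continuous_on ({0..\<alpha>} \<union> {\<alpha>..1}) p"
    unfolding p_def
    by (rule continuous_on_If)
      (use c1 match in \<open>auto intro!: continuous_on_compose2[OF c2] continuous_intros intro: antisym\<close>)
  also have "{0..\<alpha>} \<union> {\<alpha>..1} = {0..1}" using alpha by auto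
  finally have pc: "continuous_on {0..1} p" .
  have ppos: "0 < p x" if "0 < x" "x < 1" for x
    using 1(3) 2(3) pa that by (cases x \<alpha> rule: linorder_cases) (auto simp: p_def half_orbit_def)
  have pd: "(p has_real_derivative R x) (at x)" if x: "0 < x" "x < 1" "x \<noteq> \<alpha>" for x
  proof (cases "x < \<alpha>")
    case True
    have "(p1 has_real_derivative R x) (at x)"
      using 1(3) True x by (simp add: half_orbit_def R_def p_def)
    then show ?thesis
      by (rule has_field_derivative_transform_within_open[where S = "{..<\<alpha>}"])
        (use True in \<open>auto simp: p_def\<close>)
  next
    case False
    then have "\<alpha> < x" using x by simp
    have "\<forall>z. 0 < z \<longrightarrow> z < 1 - \<alpha> \<longrightarrow> (p2 has_real_derivative (s * g (1 - z) + f (1 - z) / p2 z)) (at z)"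
      using 2(3) by (simp add: half_orbit_def)
    from this[rule_format, of "1 - x"]
    have "(p2 has_real_derivative (s * g x + f x / p2 (1 - x))) (at (1 - x))"
      using \<open>\<alpha> < x\<close> x by simp
    from DERIV_reflect[OF this] have "(reflect p2 has_real_derivative R x) (at x)"
      using \<open>\<alpha> < x\<close> by (simp add: R_def p_def)
    then show ?thesis
      by (rule has_field_derivative_transform_within_open[where S = "{\<alpha><..}"])
        (use \<open>\<alpha> < x\<close> in \<open>auto simp: p_def\<close>)
  qed
  have pcont: "isCont p \<alpha>"
    by (rule continuous_on_interior[OF pc]) (use alpha in auto)
  have "(p has_real_derivative R \<alpha>) (at \<alpha>)"
  proof (rule DERIV_of_punctured_derivative[of 0 \<alpha> 1])
    show "isCont R \<alpha>"
      unfolding R_def using pcont ppos[of \<alpha>] alpha DERIV_isCont[OF f_deriv] g_cont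
      by (intro continuous_intros) (auto simp: continuous_on_eq_continuous_at)
  qed (use alpha pcont pd in auto)
  then have pd': "(p has_real_derivative R x) (at x)" if "0 < x" "x < 1" for x
    using pd[OF that] by (cases "x = \<alpha>") auto
  have orb: "orbit f g s p"
    unfolding orbit_def using pc ppos pd' z alpha by (simp add: R_def) (simp add: p_def)
  \<comment> \<open>Each branch has its linear bound at its own end only. On the other branch the
    distance to that end is at least \<alpha> or \<open>1 - \<alpha>\<close>, which produces the two
    quotients.\<close>
  define C where "C = C1 + C2 + C2 / \<alpha> + C1 / (1 - \<alpha>)"
  have C: "0 < C" "C1 \<le> C" "C2 \<le> C" "C2 / \<alpha> \<le> C" "C1 / (1 - \<alpha>) \<le> C"
    using 1(2) 2(2) alpha by (auto simp: C_def add_nonneg_nonneg intro!: add_pos_pos)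
  have ub1: "p x \<le> C * x" if x: "x \<in> {0..1}" for x
  proof (cases "x \<le> \<alpha>")
    case True
    then have "p x \<le> C1 * x" using 1(5)[of x] x by (simp add: p_def)
    also have "\<dots> \<le> C * x" using C x by (intro mult_right_mono) auto
    finally show ?thesis .
  next
    case False
    then have "p x \<le> C2 * (1 - x)" using 2(5)[of "1 - x"] x by (simp add: p_def)
    also have "\<dots> \<le> C2 * (x / \<alpha>)"
    proof (rule mult_left_mono)
      have "1 - x \<le> 1" using x by simp
      also have "1 \<le> x / \<alpha>" using False alpha by simp
      finally show "1 - x \<le> x / \<alpha>" .
    qed (use 2 in simp)
    also have "\<dots> = (C2 / \<alpha>) * x" by simp
    also have "\<dots> \<le> C * x" using C x by (intro mult_right_mono) auto
    finally show ?thesis .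
  qed
  have ub2: "p x \<le> C * (1 - x)" if x: "x \<in> {0..1}" for x
  proof (cases "x \<le> \<alpha>")
    case True
    then have "p x \<le> C1 * x" using 1(5)[of x] x by (simp add: p_def)
    also have "\<dots> \<le> C1 * ((1 - x) / (1 - \<alpha>))"
    proof (rule mult_left_mono)
      have "x \<le> 1" using x by simp
      also have "1 \<le> (1 - x) / (1 - \<alpha>)" using True alpha by simp
      finally show "x \<le> (1 - x) / (1 - \<alpha>)" .
    qed (use 1 in simp)
    also have "\<dots> = (C1 / (1 - \<alpha>)) * (1 - x)" by simp
    also have "\<dots> \<le> C * (1 - x)" using C x by (intro mult_right_mono) auto
    finally show ?thesis .
  next
    case False
    then have "p x \<le> C2 * (1 - x)" using 2(5)[of "1 - x"] x by (simp add: p_def)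
    also have "\<dots> \<le> C * (1 - x)" using C x by (intro mult_right_mono) auto
    finally show ?thesis .
  qed
  define \<kappa> where "\<kappa> = min \<kappa>1 \<kappa>2"
  have lb1: "\<kappa> * - f x \<le> p x" if "x \<in> {0..\<alpha>}" for x
  proof -
    have "0 \<le> - f x" using f_neg(1)[of x] f_zeros that by (cases "x = 0 \<or> x = \<alpha>") auto
    then have "\<kappa> * - f x \<le> \<kappa>1 * - f x" by (intro mult_right_mono) (auto simp: \<kappa>_def)
    also have "\<dots> \<le> p x" using 1(4)[OF that] that by (simp add: p_def)
    finally show ?thesis .
  qed
  have lb2: "\<kappa> * f x \<le> p x" if "x \<in> {\<alpha>..1}" for x
  proof -
    have "0 \<le> f x" using f_pos(2)[of x] f_zeros that by (cases "x = \<alpha> \<or> x = 1") auto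
    then have "\<kappa> * f x \<le> \<kappa>2 * f x" by (intro mult_right_mono) (auto simp: \<kappa>_def)
    also have "\<dots> \<le> p x"
      using 2(4)[of "1 - x"] that match by (cases "x = \<alpha>") (auto simp: p_def)
    finally show ?thesis .
  qed
  show ?thesis
    by (rule that[OF _ C(1) orb ub1 ub2 lb1 lb2]) (use 1 2 in \<open>auto simp: \<kappa>_def\<close>)
qed

end


section \<open>Exponential decay at the rest states\<close>

lemma front_decay_at_bot:
  fixes u p :: "real \<Rightarrow> real"
  assumes u: "\<And>t. 0 < u t" "\<And>t. u t < 1" "\<And>t. (u has_real_derivative p (u t)) (at t)"
    and lim: "(u \<longlongrightarrow> 0) at_bot" and kap: "0 < \<kappa>"
    and low: "\<And>x. x \<in> {0..\<alpha>} \<Longrightarrow> \<kappa> * - f x \<le> p x"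
  obtains C \<mu> where "0 < C" "0 < \<mu>" "\<And>t. u t \<le> C * exp (\<mu> * t)"
proof -
  \<comment> \<open>Near 0 half of the slope survives: \<open>- f x\<close> is at least
    \<open>- f' 0 / 2 * x\<close>. Through the lower bound on \<open>p\<close> this becomes
    \<open>\<mu> * u \<le> u'\<close> with \<mu> as below, that is, decay backward in time.\<close>
  have "((\<lambda>x. f x - f' 0 / 2 * x) has_real_derivative f' 0 / 2) (at 0)"
    by (auto intro!: derivative_eq_intros f_deriv)
  moreover have "f' 0 / 2 < 0" using f'_ends by simp
  ultimately obtain d where d: "0 < d" "\<And>h. 0 < h \<Longrightarrow> h < d \<Longrightarrow> f h < f' 0 / 2 * h"
    using has_real_derivative_neg_dec_right[of "\<lambda>x. f x - f' 0 / 2 * x" "f' 0 / 2" 0 UNIV] f_zeros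
    by auto
  define \<mu> where "\<mu> = \<kappa> * (- f' 0 / 2)"
  have mu: "0 < \<mu>" unfolding \<mu>_def using kap f'_ends by (intro mult_pos_pos) auto
  obtain T where T: "\<And>t. t \<le> T \<Longrightarrow> u t < min d \<alpha>"
    using order_tendstoD(2)[OF lim, of "min d \<alpha>"] d alpha by (auto simp: eventually_at_bot_linorder)
  have grow: "\<mu> * u t \<le> p (u t)" if "t \<le> T" for t
  proof -
    have "\<mu> * u t = \<kappa> * - (f' 0 / 2 * u t)" by (simp add: \<mu>_def)
    also have "\<dots> \<le> \<kappa> * - f (u t)"
      using d(2)[of "u t"] u(1)[of t] T[OF that] kap by (intro mult_left_mono) auto
    also have "\<dots> \<le> p (u t)"
      using T[OF that] u(1)[of t] by (intro low) auto
    finally show ?thesis .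
  qed
  have "u t \<le> exp (- \<mu> * T) * exp (\<mu> * t)" for t
  proof (cases "t \<le> T")
    case True
    have "exp (- \<mu> * t) * u t \<le> exp (- \<mu> * T) * u T"
    proof (rule DERIV_nonneg_imp_nondecreasing[where f = "\<lambda>t. exp (- \<mu> * t) * u t", OF True])
      fix x assume "t \<le> x" "x \<le> T"
      have "((\<lambda>t. exp (- \<mu> * t) * u t) has_real_derivative exp (- \<mu> * x) * (p (u x) - \<mu> * u x)) (at x)"
        by (auto intro!: derivative_eq_intros u simp: algebra_simps)
      then show "\<exists>l. ((\<lambda>t. exp (- \<mu> * t) * u t) has_real_derivative l) (at x) \<and> 0 \<le> l"
        using grow[OF \<open>x \<le> T\<close>] by (intro exI conjI) auto
    qed
    also have "\<dots> \<le> exp (- \<mu> * T)" using u(1,2)[of T] by (simp add: mult_left_le less_imp_le)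
    finally have "exp (\<mu> * t) * (exp (- \<mu> * t) * u t) \<le> exp (\<mu> * t) * exp (- \<mu> * T)"
      by (rule mult_left_mono) simp
    then show ?thesis by (simp add: mult.commute exp_minus field_simps)
  next
    case False
    then have "1 \<le> exp (- \<mu> * T + \<mu> * t)" using mu by simp
    then show ?thesis using u(2)[of t] unfolding exp_add by linarith
  qed
  then show ?thesis using mu by (intro that[of "exp (- \<mu> * T)" \<mu>]) auto
qed

lemma front_decay_at_top:
  fixes u p :: "real \<Rightarrow> real"
  assumes u: "\<And>t. 0 < u t" "\<And>t. u t < 1" "\<And>t. (u has_real_derivative p (u t)) (at t)"
    and lim: "(u \<longlongrightarrow> 1) at_top" and kap: "0 < \<kappa>"
    and low: "\<And>x. x \<in> {\<alpha>..1} \<Longrightarrow> \<kappa> * f x \<le> p x"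
  obtains C \<mu> where "0 < C" "0 < \<mu>" "\<And>t. 1 - u t \<le> C * exp (- \<mu> * t)"
proof -
  interpret R: bistable_reaction "\<lambda>x. - f (1 - x)" "reflect f'" "1 - \<alpha>"
    by (rule reflect_bistable)
  have der: "((\<lambda>t. 1 - u (- t)) has_real_derivative reflect p (1 - u (- t))) (at t)" for t
    using DERIV_mirror_minus[OF u(3)] by (auto intro!: derivative_eq_intros)
  have "((\<lambda>t. u (- t)) \<longlongrightarrow> 1) at_bot" using lim by (simp add: filterlim_at_bot_mirror)
  then have lim': "((\<lambda>t. 1 - u (- t)) \<longlongrightarrow> 0) at_bot" by (auto intro!: tendsto_eq_intros)
  have low': "\<kappa> * - (- f (1 - x)) \<le> reflect p x" if "x \<in> {0..1 - \<alpha>}" for x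
    using low[of "1 - x"] that by simp
  obtain C \<mu> where C: "0 < C" "0 < \<mu>" "\<And>t. 1 - u (- t) \<le> C * exp (\<mu> * t)"
    by (rule R.front_decay_at_bot[OF _ _ der lim' kap low']) (use u that in auto)
  have "1 - u t \<le> C * exp (- \<mu> * t)" for t using C(3)[of "- t"] by simp
  with C(1,2) show ?thesis by (rule that)
qed

section \<open>Damping of the hyperbolic profile and positivity of the flux\<close>

definition damping :: "real \<Rightarrow> real \<Rightarrow> real" where
  "damping \<tau> x = 1 - \<tau> * f' x"

lemma damping_cont: "continuous_on UNIV (damping \<tau>)"
  unfolding damping_def by (intro continuous_intros f'_cont)

text \<open>The quantity is \<open>V\<close> up to a positive factor; its derivative in \<open>x\<close> is \<open>- s - f / p\<close>.\<close>

lemma orbit_flux_pos_aux: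
  assumes orb: "orbit f (damping \<tau>) s p" and tau: "0 \<le> \<tau>" and s: "s \<le> 0" and x: "0 < x" "x < 1"
  shows "0 < p x - s * \<tau> * f x"
proof (cases "\<alpha> \<le> x")
  case True
  then have "0 \<le> f x" using f_pos(2)[of x] f_zeros x by (cases "x = \<alpha>") auto
  then have "0 \<le> - s * \<tau> * f x" using s tau by (intro mult_nonneg_nonneg) auto
  moreover have "0 < p x" using orb x by (simp add: orbit_def)
  ultimately show ?thesis by linarith
next
  case False
  have "p 0 - s * \<tau> * f 0 < p x - s * \<tau> * f x"
  proof (rule DERIV_pos_imp_increasing_open[where f = "\<lambda>x. p x - s * \<tau> * f x", OF x(1)])
    fix z assume z: "0 < z" "z < x"
    have p: "0 < p z" "(p has_real_derivative (- s * damping \<tau> z - f z / p z)) (at z)"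
      using orb z x by (auto simp: orbit_def)
    have "((\<lambda>x. p x - s * \<tau> * f x) has_real_derivative - s * damping \<tau> z - f z / p z - s * \<tau> * f' z) (at z)"
      by (auto intro!: derivative_eq_intros p f_deriv)
    moreover have "- s * damping \<tau> z - f z / p z - s * \<tau> * f' z = - s + - f z / p z"
      by (simp add: damping_def algebra_simps)
    moreover have "0 < - f z / p z"
      using f_neg(1)[of z] z False p by (intro divide_pos_pos) auto
    ultimately show "\<exists>y. ((\<lambda>x. p x - s * \<tau> * f x) has_real_derivative y) (at z) \<and> 0 < y"
      using s by (intro exI conjI) auto
  next
    have "continuous_on {0..1} p" using orb by (simp add: orbit_def)
    then have "continuous_on {0..x} p" by (rule continuous_on_subset) (use x in auto)
    then show "continuous_on {0..x} (\<lambda>x. p x - s * \<tau> * f x)"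
      by (intro continuous_intros f_cont)
  qed
  then show ?thesis using orb f_zeros by (simp add: orbit_def)
qed

lemma orbit_flux_pos:
  assumes orb: "orbit f (damping \<tau>) s p" and tau: "0 \<le> \<tau>" and x: "0 < x" "x < 1"
  shows "0 < p x - s * \<tau> * f x"
proof (cases "s \<le> 0")
  case True
  then show ?thesis using orbit_flux_pos_aux[OF orb tau _ x] by simp
next
  case False
  interpret R: bistable_reaction "\<lambda>x. - f (1 - x)" "reflect f'" "1 - \<alpha>"
    by (rule reflect_bistable)
  \<comment> \<open>The flux is invariant under reflection, because \<open>s\<close> and
    \<open>f\<close> both change sign.\<close>
  have "R.damping \<tau> = reflect (damping \<tau>)"
    by (simp add: R.damping_def damping_def fun_eq_iff)
  then show ?thesis
    using R.orbit_flux_pos_aux[of \<tau> "- s" "reflect p" "1 - x"] orbit_reflect[OF orb] tau x False by simp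
qed

section \<open>The speed as a function of the damping\<close>

definition speed :: "(real \<Rightarrow> real) \<Rightarrow> real" where
  "speed g = (SOME s. mismatch f \<alpha> g s = 0)"

context
  fixes g :: "real \<Rightarrow> real"
  assumes g_cont: "continuous_on UNIV g"
    and g_pos: "\<And>x. x \<in> {0..1} \<Longrightarrow> 0 < g x"
begin

lemma mismatch_speed: "mismatch f \<alpha> g (speed g) = 0"
proof -
  have "\<exists>s. mismatch f \<alpha> g s = 0" by (rule mismatch_root_exists[OF g_cont g_pos])
  then show ?thesis unfolding speed_def by (rule someI_ex)
qed

lemma normal_front_speed:
  assumes "normal_front f g s u y"
  shows "s = speed g"
proof -
  obtain p where "orbit f g (speed g) p"
    by (rule orbit_of_mismatch_root[OF g_cont g_pos mismatch_speed])
  then show ?thesis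
    using front_speed_eq_orbit_speed[OF g_cont g_pos assms] by blast
qed

text \<open>Weak monotonicity would allow an interval of roots. Each root is therefore realised by
  an actual front, whose speed is compared with the orbit of the chosen root; this upgrades the
  mismatch to strict signs on either side of \<open>speed g\<close>.\<close>

lemma mismatch_root_unique:
  assumes root: "mismatch f \<alpha> g s = 0"
  shows "s = speed g"
proof -
  obtain \<kappa> C p where C: "0 < C" "orbit f g s p"
    "\<And>x. x \<in> {0..1} \<Longrightarrow> p x \<le> C * x" "\<And>x. x \<in> {0..1} \<Longrightarrow> p x \<le> C * (1 - x)"
    by (rule orbit_of_mismatch_root[OF g_cont g_pos root]) (assumption, rule that)
  obtain u where "normal_front f g s u (\<lambda>t. p (u t))"
    by (rule normal_front_of_orbit[OF C(2,1,3,4)])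
  then show ?thesis by (rule normal_front_speed)
qed

lemma mismatch_pos: "s < speed g \<Longrightarrow> 0 < mismatch f \<alpha> g s"
  using mismatch_antimono[OF g_cont g_pos, of s "speed g"] mismatch_speed mismatch_root_unique[of s]
  by force

lemma mismatch_neg: "speed g < s \<Longrightarrow> mismatch f \<alpha> g s < 0"
  using mismatch_antimono[OF g_cont g_pos, of "speed g" s] mismatch_speed mismatch_root_unique[of s]
  by force

end

text \<open>A strict sign of the mismatch at a fixed \<open>s\<close> persists for nearby \<tau>,
  and monotonicity in \<open>s\<close> then keeps the root on the same side of \<open>s\<close>.
  With a general set \<open>S\<close> the endpoint \<tau> = 0 can be included.\<close>

lemma continuous_on_speed:
  assumes pos: "\<And>\<tau> x. \<tau> \<in> S \<Longrightarrow> x \<in> {0..1} \<Longrightarrow> 0 < damping \<tau> x"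
  shows "continuous_on S (\<lambda>\<tau>. speed (damping \<tau>))"
  unfolding continuous_on_def
proof
  fix \<tau>0 assume t0: "\<tau>0 \<in> S"
  obtain B where B: "0 < B" "\<And>x. x \<in> {0..1} \<Longrightarrow> \<bar>f' x\<bar> \<le> B"
    using continuous_on_Icc_abs_bound[OF continuous_on_subset[OF f'_cont, of "{0..1}"]] by blast
  have cont: "((\<lambda>\<tau>. mismatch f \<alpha> (damping \<tau>) s) \<longlongrightarrow> mismatch f \<alpha> (damping \<tau>0) s) (at \<tau>0 within S)" for s
  proof -
    have "(2 * (\<bar>s\<bar> * B))-lipschitz_on UNIV (\<lambda>\<tau>. mismatch f \<alpha> (damping \<tau>) s)"
    proof (rule lipschitz_onI)
      fix a b :: real
      have "\<bar>mismatch f \<alpha> (damping a) s - mismatch f \<alpha> (damping b) s\<bar> \<le> 2 * (\<bar>s\<bar> * B * \<bar>a - b\<bar>)"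
      proof (rule mismatch_lipschitz[OF damping_cont damping_cont])
        fix x :: real assume x: "x \<in> {0..1}"
        have "s * damping a x - s * damping b x = - (s * (f' x * (a - b)))"
          by (simp add: damping_def algebra_simps)
        then have "\<bar>s * damping a x - s * damping b x\<bar> = \<bar>s\<bar> * (\<bar>f' x\<bar> * \<bar>a - b\<bar>)"
          by (simp add: abs_mult)
        also have "\<dots> \<le> \<bar>s\<bar> * (B * \<bar>a - b\<bar>)"
          using B(2)[OF x] by (intro mult_left_mono mult_right_mono) auto
        finally show "\<bar>s * damping a x - s * damping b x\<bar> \<le> \<bar>s\<bar> * B * \<bar>a - b\<bar>"
          by (simp add: mult.assoc)
      qed (use B in simp)
      then show "dist (mismatch f \<alpha> (damping a) s) (mismatch f \<alpha> (damping b) s)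
          \<le> 2 * (\<bar>s\<bar> * B) * dist a b"
        by (simp add: dist_real_def)
    qed (use B in simp)
    then have "continuous_on S (\<lambda>\<tau>. mismatch f \<alpha> (damping \<tau>) s)"
      using lipschitz_on_continuous_on continuous_on_subset subset_UNIV by blast
    then show ?thesis using t0 by (simp add: continuous_on_def)
  qed
  have in_S: "eventually (\<lambda>\<tau>. \<tau> \<in> S) (at \<tau>0 within S)"
    by (simp add: eventually_at_filter)
  show "((\<lambda>\<tau>. speed (damping \<tau>)) \<longlongrightarrow> speed (damping \<tau>0)) (at \<tau>0 within S)"
  proof (rule order_tendstoI)
    fix s assume "s < speed (damping \<tau>0)"
    then have "0 < mismatch f \<alpha> (damping \<tau>0) s"
      using mismatch_pos[OF damping_cont pos[OF t0]] by simp
    from order_tendstoD(1)[OF cont this] in_S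
    show "eventually (\<lambda>\<tau>. s < speed (damping \<tau>)) (at \<tau>0 within S)"
    proof eventually_elim
      case (elim \<tau>)
      then show ?case
        using mismatch_antimono[OF damping_cont pos, of \<tau> "speed (damping \<tau>)" s]
          mismatch_speed[OF damping_cont pos, of \<tau>]
        by (cases "speed (damping \<tau>) \<le> s") auto
    qed
  next
    fix s assume "speed (damping \<tau>0) < s"
    then have "mismatch f \<alpha> (damping \<tau>0) s < 0"
      using mismatch_neg[OF damping_cont pos[OF t0]] by simp
    from order_tendstoD(2)[OF cont this] in_S
    show "eventually (\<lambda>\<tau>. speed (damping \<tau>) < s) (at \<tau>0 within S)"
    proof eventually_elim
      case (elim \<tau>)
      then show ?case
        using mismatch_antimono[OF damping_cont pos, of \<tau> s "speed (damping \<tau>)"]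
          mismatch_speed[OF damping_cont pos, of \<tau>]
        by (cases "s \<le> speed (damping \<tau>)") auto
    qed
  qed
qed

lemma normal_front_exists:
  assumes tau: "0 \<le> \<tau>" and pos: "\<And>x. x \<in> {0..1} \<Longrightarrow> 0 < damping \<tau> x"
    and s: "s = speed (damping \<tau>)"
  obtains u y C \<mu> where "normal_front f (damping \<tau>) s u y"
    "\<And>t. 0 < u t" "\<And>t. u t < 1" "\<And>t. 0 < y t" "\<And>t. 0 < y t - s * \<tau> * f (u t)"
    "0 < C" "0 < \<mu>"
    "\<And>t. t \<le> 0 \<Longrightarrow> u t + (y t - s * \<tau> * f (u t)) \<le> C * exp (\<mu> * t)"
    "\<And>t. 0 \<le> t \<Longrightarrow> (1 - u t) + (y t - s * \<tau> * f (u t)) \<le> C * exp (- \<mu> * t)"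
proof -
  interpret R: bistable_reaction "\<lambda>x. - f (1 - x)" "reflect f'" "1 - \<alpha>"
    by (rule reflect_bistable)
  have root: "mismatch f \<alpha> (damping \<tau>) s = 0"
    unfolding s by (rule mismatch_speed[OF damping_cont pos])
  obtain \<kappa> K p where p: "0 < \<kappa>" "0 < K" "orbit f (damping \<tau>) s p"
    "\<And>x. x \<in> {0..1} \<Longrightarrow> p x \<le> K * x" "\<And>x. x \<in> {0..1} \<Longrightarrow> p x \<le> K * (1 - x)"
    "\<And>x. x \<in> {0..\<alpha>} \<Longrightarrow> \<kappa> * - f x \<le> p x" "\<And>x. x \<in> {\<alpha>..1} \<Longrightarrow> \<kappa> * f x \<le> p x"
    by (rule orbit_of_mismatch_root[OF damping_cont pos root]) (use that in auto)
  obtain u where nf: "normal_front f (damping \<tau>) s u (\<lambda>t. p (u t))" and u: "\<And>t. 0 < u t" "\<And>t. u t < 1"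
    by (rule normal_front_of_orbit[OF p(3,2,4,5)]) (assumption, assumption, rule that)
  have der: "\<And>t. (u has_real_derivative p (u t)) (at t)" and lims: "(u \<longlongrightarrow> 0) at_bot" "(u \<longlongrightarrow> 1) at_top"
    using nf by (auto simp: normal_front_def)
  obtain C1 \<mu>1 where 1: "0 < C1" "0 < \<mu>1" "\<And>t. u t \<le> C1 * exp (\<mu>1 * t)"
    by (rule front_decay_at_bot[OF u der lims(1) p(1,6)]) (assumption, rule that)
  obtain C2 \<mu>2 where 2: "0 < C2" "0 < \<mu>2" "\<And>t. 1 - u t \<le> C2 * exp (- \<mu>2 * t)"
    by (rule front_decay_at_top[OF u der lims(2) p(1,7)]) (assumption, rule that)
  obtain M1 where M1: "0 < M1" "\<And>x. x \<in> {0..1} \<Longrightarrow> \<bar>f x\<bar> \<le> M1 * x"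
    using f_linear_bound by blast
  obtain M2 where M2: "0 < M2" "\<And>x. x \<in> {0..1} \<Longrightarrow> \<bar>- f (1 - x)\<bar> \<le> M2 * x"
    using R.f_linear_bound by blast
  \<comment> \<open>Collects \<open>u\<close> or \<open>1 - u\<close> itself, the linear bound
    \<open>K\<close> on \<open>p\<close>, and the linear bounds \<open>M1\<close> at 0 and
    \<open>M2\<close> at 1 for the reaction part of the flux.\<close>
  define A where "A = 1 + K + \<bar>s\<bar> * \<tau> * (M1 + M2)"
  have A: "0 < A" using p(2) M1(1) M2(1) tau by (simp add: A_def add_pos_nonneg)
  have flux: "- (s * \<tau> * f x) \<le> \<bar>s\<bar> * \<tau> * \<bar>f x\<bar>" for x
    using abs_ge_minus_self[of "s * \<tau> * f x"] tau by (simp add: abs_mult)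
  have small0: "u t + (p (u t) - s * \<tau> * f (u t)) \<le> A * u t" for t
  proof -
    have x: "u t \<in> {0..1}" using u[of t] by auto
    have "\<bar>f (u t)\<bar> \<le> (M1 + M2) * u t"
      using M1(2)[OF x] M2(1) u(1)[of t] by (simp add: distrib_right add_increasing2)
    then have "\<bar>s\<bar> * \<tau> * \<bar>f (u t)\<bar> \<le> \<bar>s\<bar> * \<tau> * ((M1 + M2) * u t)"
      using tau by (intro mult_left_mono) auto
    then show ?thesis
      using p(4)[OF x] flux[of "u t"] by (simp add: A_def algebra_simps)
  qed
  have small1: "(1 - u t) + (p (u t) - s * \<tau> * f (u t)) \<le> A * (1 - u t)" for t
  proof -
    have x: "u t \<in> {0..1}" "1 - u t \<in> {0..1}" using u[of t] by auto
    have "0 \<le> M1 * (1 - u t)"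
      using M1(1) x by (intro mult_nonneg_nonneg) auto
    then have "\<bar>f (u t)\<bar> \<le> (M1 + M2) * (1 - u t)"
      using M2(2)[OF x(2)] by (simp add: distrib_right)
    then have "\<bar>s\<bar> * \<tau> * \<bar>f (u t)\<bar> \<le> \<bar>s\<bar> * \<tau> * ((M1 + M2) * (1 - u t))"
      using tau by (intro mult_left_mono) auto
    then have "- (s * \<tau> * f (u t)) \<le> \<bar>s\<bar> * \<tau> * (M1 + M2) * (1 - u t)"
      using flux[of "u t"] by (simp add: mult.assoc)
    moreover have "A * (1 - u t) = (1 - u t) + K * (1 - u t) + \<bar>s\<bar> * \<tau> * (M1 + M2) * (1 - u t)"
      by (simp only: A_def distrib_right mult_1)
    ultimately show ?thesis
      using p(5)[OF x(1)] by linarith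
  qed
  define C \<mu> where "C = A * (C1 + C2)" and "\<mu> = min \<mu>1 \<mu>2"
  have mu: "0 < \<mu>" "\<mu> \<le> \<mu>1" "\<mu> \<le> \<mu>2" using 1 2 by (auto simp: \<mu>_def)
  show ?thesis
  proof (rule that[OF nf u])
    show "0 < p (u t)" "0 < p (u t) - s * \<tau> * f (u t)" for t
      using p(3) u[of t] orbit_flux_pos[OF p(3) tau u, of t] by (auto simp: orbit_def)
    show "0 < C" "0 < \<mu>" using A 1 2 mu by (auto simp: C_def)
    show "u t + (p (u t) - s * \<tau> * f (u t)) \<le> C * exp (\<mu> * t)" if "t \<le> 0" for t
    proof -
      have "u t \<le> (C1 + C2) * exp (\<mu> * t)"
        by (rule order_trans[OF 1(3)], rule mult_mono) (use 1 2 mu that in \<open>auto intro: mult_right_mono_neg\<close>)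
      then have "A * u t \<le> A * ((C1 + C2) * exp (\<mu> * t))"
        using A by (intro mult_left_mono) auto
      with small0[of t] show ?thesis by (simp add: C_def mult.assoc)
    qed
    show "(1 - u t) + (p (u t) - s * \<tau> * f (u t)) \<le> C * exp (- \<mu> * t)" if "0 \<le> t" for t
    proof -
      have "1 - u t \<le> (C1 + C2) * exp (- \<mu> * t)"
        by (rule order_trans[OF 2(3)], rule mult_mono) (use 1 2 mu that in \<open>auto intro: mult_right_mono\<close>)
      then have "A * (1 - u t) \<le> A * ((C1 + C2) * exp (- \<mu> * t))"
        using A by (intro mult_left_mono) auto
      with small1[of t] show ?thesis by (simp add: C_def mult.assoc)
    qed
  qed
qed

end

section \<open>Back to the hyperbolic and parabolic profiles\<close>

lemma bistable_reaction_deriv: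
  assumes "smooth_real f" "bistable f \<alpha>"
  shows "bistable_reaction f (deriv f) \<alpha>"
proof -
  have "f differentiable_on UNIV" "deriv f differentiable_on UNIV"
    using assms(1)[unfolded smooth_real_def, rule_format, of 0]
      assms(1)[unfolded smooth_real_def, rule_format, of 1] by auto
  then have "(f has_real_derivative deriv f x) (at x)" "continuous_on UNIV (deriv f)" for x
    by (auto simp: DERIV_deriv_iff_real_differentiable differentiable_on_def
        intro: differentiable_imp_continuous_on)
  then show ?thesis
    using assms(2) unfolding bistable_def by unfold_locales auto
qed

context bistable_reaction
begin

text \<open>Subtracting \<open>c * \<tau>\<close> times the first profile equation from the second
  cancels \<open>V'\<close> and leaves \<open>r^2 * U' = V + c * \<tau> * f U\<close>. The right
  side is differentiable, so \<open>U\<close> has a second derivative, and \<open>y\<close> is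
  \<open>r * U'\<close>.\<close>

lemma normal_front_of_hyp_front:
  assumes hyp: "hyp_front f \<tau> c U V" and D: "c\<^sup>2 * \<tau> < 1" and r: "r = sqrt (1 - c\<^sup>2 * \<tau>)"
  shows "normal_front f (damping \<tau>) (c / r) (\<lambda>t. U (r * t))
    (\<lambda>t. (V (r * t) + c * \<tau> * f (U (r * t))) / r)"
proof -
  have r0: "0 < r" and r2: "r * r = 1 - c\<^sup>2 * \<tau>" using D by (auto simp: r)
  have U: "(U has_real_derivative deriv U x) (at x)" and V: "(V has_real_derivative deriv V x) (at x)" for x
    using hyp by (auto simp: hyp_front_def DERIV_deriv_iff_real_differentiable differentiable_on_def)
  have e1: "c * deriv U x + deriv V x + f (U x) = 0" and e2: "deriv U x + c * \<tau> * deriv V x - V x = 0" for x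
    using hyp by (auto simp: hyp_front_def)
  have dU: "r * r * deriv U x = V x + c * \<tau> * f (U x)" for x
  proof -
    have "r * r * deriv U x - (V x + c * \<tau> * f (U x)) =
      (deriv U x + c * \<tau> * deriv V x - V x) - c * \<tau> * (c * deriv U x + deriv V x + f (U x))"
      unfolding r2 by (simp add: algebra_simps power2_eq_square)
    then show ?thesis unfolding e1 e2 by simp
  qed
  have dV: "deriv V x = - c * deriv U x - f (U x)" for x
    using e1[of x] by linarith
  have lims: "(U \<longlongrightarrow> 0) at_bot" "(V \<longlongrightarrow> 0) at_bot" "(U \<longlongrightarrow> 1) at_top" "(V \<longlongrightarrow> 0) at_top"
    using hyp by (auto simp: hyp_front_def)
  have flim: "((\<lambda>t. f (u t)) \<longlongrightarrow> 0) F" if "(u \<longlongrightarrow> a) F" "f a = 0" for u a F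
    using isCont_tendsto_compose[OF DERIV_isCont[OF f_deriv] that(1)] that(2) by simp
  have ylim: "((\<lambda>t. (V (r * t) + c * \<tau> * f (U (r * t))) / r) \<longlongrightarrow> 0) F"
    if "((\<lambda>t. V (r * t)) \<longlongrightarrow> 0) F" "((\<lambda>t. U (r * t)) \<longlongrightarrow> a) F" "f a = 0" for a F
    using r0 by (auto intro!: tendsto_eq_intros that(1) flim[OF that(2,3)])
  show ?thesis
    unfolding normal_front_def
  proof (intro conjI allI)
    fix t
    define x where "x = r * t"
    have "r * deriv U x = (V x + c * \<tau> * f (U x)) / r"
      using dU[of x] r0 by (simp add: field_simps)
    then show "((\<lambda>t. U (r * t)) has_real_derivative (V (r * t) + c * \<tau> * f (U (r * t))) / r) (at t)"
      using DERIV_rescale[OF U, of r t] by (simp add: x_def)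
    have "((\<lambda>x. (V x + c * \<tau> * f (U x)) / r) has_real_derivative
        (deriv V x + c * \<tau> * (f' (U x) * deriv U x)) / r) (at x)"
      using r0 by (auto intro!: derivative_eq_intros V DERIV_chain2[OF f_deriv U])
    from DERIV_rescale[OF this[unfolded x_def]]
    have "((\<lambda>t. (V (r * t) + c * \<tau> * f (U (r * t))) / r) has_real_derivative
        deriv V x + c * \<tau> * (f' (U x) * deriv U x)) (at t)"
      using r0 by (simp add: x_def)
    moreover have "deriv V x + c * \<tau> * (f' (U x) * deriv U x) =
        - (c / r) * damping \<tau> (U x) * ((V x + c * \<tau> * f (U x)) / r) - f (U x)"
      unfolding dU[symmetric] dV using r0 by (simp add: damping_def field_simps)
    ultimately show "((\<lambda>t. (V (r * t) + c * \<tau> * f (U (r * t))) / r) has_real_derivative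
        - (c / r) * damping \<tau> (U (r * t)) * ((V (r * t) + c * \<tau> * f (U (r * t))) / r) - f (U (r * t))) (at t)"
      by (simp add: x_def)
  next
    note rescale = tendsto_rescale[OF r0]
    show "((\<lambda>t. U (r * t)) \<longlongrightarrow> 0) at_bot" "((\<lambda>t. U (r * t)) \<longlongrightarrow> 1) at_top"
      by (rule rescale lims)+
    show "((\<lambda>t. (V (r * t) + c * \<tau> * f (U (r * t))) / r) \<longlongrightarrow> 0) at_bot"
      by (rule ylim[OF rescale(1)[OF lims(2)] rescale(1)[OF lims(1)] f_zeros(1)])
    show "((\<lambda>t. (V (r * t) + c * \<tau> * f (U (r * t))) / r) \<longlongrightarrow> 0) at_top"
      by (rule ylim[OF rescale(2)[OF lims(4)] rescale(2)[OF lims(3)] f_zeros(3)])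
  qed
qed

lemma normal_front_of_parab_front:
  assumes "parab_front f c U"
  shows "normal_front f (damping 0) c U (deriv U)"
proof -
  have U: "(U has_real_derivative deriv U x) (at x)"
    and U2: "(deriv U has_real_derivative deriv (deriv U) x) (at x)" for x
    using assms by (auto simp: parab_front_def DERIV_deriv_iff_real_differentiable differentiable_on_def)
  have eq: "deriv (deriv U) x = - c * deriv U x - f (U x)" for x
    using assms by (simp add: parab_front_def algebra_simps eq_neg_iff_add_eq_0)
  have lims: "(U \<longlongrightarrow> 0) at_bot" "(U \<longlongrightarrow> 1) at_top"
    using assms by (auto simp: parab_front_def)
  have flim: "((\<lambda>t. f (u t)) \<longlongrightarrow> 0) F" if "(u \<longlongrightarrow> a) F" "f a = 0" for u a F
    using isCont_tendsto_compose[OF DERIV_isCont[OF f_deriv] that(1)] that(2) by simp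
  have "(deriv U \<longlongrightarrow> 0) at_bot" "(deriv U \<longlongrightarrow> 0) at_top"
    using derivative_vanishes_at_bot[OF U lims(1) U2[unfolded eq] flim[OF lims(1)]]
      derivative_vanishes_at_top[OF U lims(2) U2[unfolded eq] flim[OF lims(2)]] f_zeros by auto
  then show ?thesis
    using U U2 lims by (simp add: normal_front_def damping_def eq)
qed

lemma parab_front_of_normal_front:
  assumes "normal_front f (damping 0) c u y"
  shows "parab_front f c u"
proof -
  have u: "(u has_real_derivative y t) (at t)"
    and y: "(y has_real_derivative (- c * y t - f (u t))) (at t)" for t
    using assms by (auto simp: normal_front_def damping_def)
  have du: "deriv u = y" and dy: "deriv y t = - c * y t - f (u t)" for t
    using DERIV_imp_deriv[OF u] DERIV_imp_deriv[OF y] by auto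
  have "u differentiable_on UNIV" "y differentiable_on UNIV"
    using u y by (auto simp: differentiable_on_def real_differentiable_def)
  then show ?thesis
    using assms by (simp add: parab_front_def du dy normal_front_def)
qed

text \<open>Inverts the rescaling: \<open>c = s * r\<close> gives
  \<open>r^2 = 1 - c^2 * \<tau>\<close>, and solving \<open>r^2 * U' = V + c * \<tau> * f U\<close>
  for \<open>V\<close> with \<open>U' = y / r\<close> gives the second component.\<close>

lemma hyp_front_of_normal_front:
  assumes nf: "normal_front f (damping \<tau>) s u y" and tau: "0 \<le> \<tau>"
    and r: "r = 1 / sqrt (1 + s\<^sup>2 * \<tau>)"
  shows "hyp_front f \<tau> (s * r) (\<lambda>x. u (1 / r * x)) (\<lambda>x. r * (y (1 / r * x) - s * \<tau> * f (u (1 / r * x))))"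
proof -
  have den: "0 < 1 + s\<^sup>2 * \<tau>" using tau by (simp add: add_pos_nonneg)
  have r0: "0 < r" and r2: "r * r * (1 + s\<^sup>2 * \<tau>) = 1" using den by (auto simp: r)
  have u: "(u has_real_derivative y t) (at t)"
    and y: "(y has_real_derivative (- s * damping \<tau> (u t) * y t - f (u t))) (at t)" for t
    using nf by (auto simp: normal_front_def)
  have lims: "(u \<longlongrightarrow> 0) at_bot" "(u \<longlongrightarrow> 1) at_top" "(y \<longlongrightarrow> 0) at_bot" "(y \<longlongrightarrow> 0) at_top"
    using nf by (auto simp: normal_front_def)
  define U V where "U x = u (1 / r * x)" and "V x = r * (y (1 / r * x) - s * \<tau> * f (u (1 / r * x)))" for x
  have U': "(U has_real_derivative 1 / r * y (1 / r * x)) (at x)" for x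
    unfolding U_def by (rule DERIV_rescale[OF u])
  have V': "(V has_real_derivative - s * y (1 / r * x) - f (U x)) (at x)" for x
  proof -
    define t where "t = 1 / r * x"
    have "((\<lambda>t. y t - s * \<tau> * f (u t)) has_real_derivative
        (- s * damping \<tau> (u t) * y t - f (u t)) - s * \<tau> * (f' (u t) * y t)) (at t)"
      by (auto intro!: derivative_eq_intros y DERIV_chain2[OF f_deriv u])
    also have "(- s * damping \<tau> (u t) * y t - f (u t)) - s * \<tau> * (f' (u t) * y t) = - s * y t - f (u t)"
      by (simp add: damping_def algebra_simps)
    finally have "(V has_real_derivative r * (1 / r * (- s * y t - f (u t)))) (at x)"
      unfolding V_def t_def by (intro DERIV_cmult DERIV_rescale)
    then show ?thesis using r0 by (simp add: t_def U_def)
  qed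
  have "hyp_front f \<tau> (s * r) U V"
    unfolding hyp_front_def
  proof (intro conjI allI)
    show "U differentiable_on UNIV" "V differentiable_on UNIV"
      using U' V' by (auto simp: differentiable_on_def real_differentiable_def)
    fix x
    show "s * r * deriv U x + deriv V x + f (U x) = 0"
      using r0 by (simp add: DERIV_imp_deriv[OF U'] DERIV_imp_deriv[OF V'])
    have "deriv U x + s * r * \<tau> * deriv V x - V x = y (1 / r * x) * (1 / r - r * (1 + s\<^sup>2 * \<tau>))"
      unfolding DERIV_imp_deriv[OF U'] DERIV_imp_deriv[OF V'] V_def U_def
      by (simp add: algebra_simps power2_eq_square)
    also have "1 / r - r * (1 + s\<^sup>2 * \<tau>) = 0"
      using r2 r0 by (simp add: field_simps)
    finally show "deriv U x + s * r * \<tau> * deriv V x - V x = 0" by simp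
  next
    have flim: "((\<lambda>t. f (u t)) \<longlongrightarrow> 0) F" if "(u \<longlongrightarrow> a) F" "f a = 0" for a F
      using isCont_tendsto_compose[OF DERIV_isCont[OF f_deriv] that(1)] that(2) by simp
    have vlim: "((\<lambda>t. r * (y t - s * \<tau> * f (u t))) \<longlongrightarrow> 0) at_bot" "((\<lambda>t. r * (y t - s * \<tau> * f (u t))) \<longlongrightarrow> 0) at_top"
      using f_zeros by (auto intro!: tendsto_eq_intros lims flim)
    have "0 < 1 / r" using r0 by simp
    note rescale = tendsto_rescale[OF this]
    show "(V \<longlongrightarrow> 0) at_bot" "(V \<longlongrightarrow> 0) at_top"
      unfolding V_def by (rule rescale(1)[OF vlim(1)], rule rescale(2)[OF vlim(2)])
    show "(U \<longlongrightarrow> 0) at_bot" "(U \<longlongrightarrow> 1) at_top"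
      unfolding U_def by (rule rescale lims)+
  qed
  then show ?thesis by (simp add: U_def[abs_def] V_def[abs_def])
qed

section \<open>Positive damping below the critical \<tau>, and the hyperbolic wave\<close>

lemma abs_f'_le_Sup:
  assumes "x \<in> {0..1}"
  shows "\<bar>f' x\<bar> \<le> Sup ((\<lambda>u. \<bar>f' u\<bar>) ` {0..1})"
proof -
  have "compact ((\<lambda>u. \<bar>f' u\<bar>) ` {0..1})"
    by (intro compact_continuous_image continuous_intros continuous_on_subset[OF f'_cont]) auto
  then show ?thesis
    using assms by (intro cSup_upper bounded_imp_bdd_above compact_imp_bounded) auto
qed

lemma Sup_abs_f'_pos: "0 < Sup ((\<lambda>u. \<bar>f' u\<bar>) ` {0..1})"
  using abs_f'_le_Sup[of 0] f'_ends by simp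

lemma damping_pos:
  assumes tau: "0 \<le> \<tau>" "\<tau> < 1 / Sup ((\<lambda>u. \<bar>f' u\<bar>) ` {0..1})" and x: "x \<in> {0..1}"
  shows "0 < damping \<tau> x"
proof -
  let ?S = "Sup ((\<lambda>u. \<bar>f' u\<bar>) ` {0..1})"
  have "\<tau> * ?S < 1" using tau(2) Sup_abs_f'_pos by (simp add: field_simps)
  moreover have "\<tau> * f' x \<le> \<tau> * ?S" using abs_f'_le_Sup[OF x] tau(1) by (intro mult_left_mono) auto
  ultimately show ?thesis by (simp add: damping_def)
qed

lemma hyp_front_exists:
  assumes tau: "0 \<le> \<tau>" and pos: "\<And>x. x \<in> {0..1} \<Longrightarrow> 0 < damping \<tau> x"
    and s: "s = speed (damping \<tau>)"
  shows "\<exists>U V. hyp_front f \<tau> (s / sqrt (1 + s\<^sup>2 * \<tau>)) U V \<and> mono U \<and>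
    (\<forall>\<xi>. U \<xi> > 0 \<and> V \<xi> > 0) \<and> exp_convergent U V"
proof -
  define r where "r = 1 / sqrt (1 + s\<^sup>2 * \<tau>)"
  have den: "1 \<le> 1 + s\<^sup>2 * \<tau>" using tau by simp
  then have r: "0 < r" "r \<le> 1" by (auto simp: r_def)
  obtain u y C \<mu> where nf: "normal_front f (damping \<tau>) s u y"
    and u: "\<And>t. 0 < u t" "\<And>t. u t < 1" and y: "\<And>t. 0 < y t" "\<And>t. 0 < y t - s * \<tau> * f (u t)"
    and C: "0 < C" "0 < \<mu>"
      "\<And>t. t \<le> 0 \<Longrightarrow> u t + (y t - s * \<tau> * f (u t)) \<le> C * exp (\<mu> * t)"
      "\<And>t. 0 \<le> t \<Longrightarrow> (1 - u t) + (y t - s * \<tau> * f (u t)) \<le> C * exp (- \<mu> * t)"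
    by (rule normal_front_exists[OF tau pos s]) (assumption, rule that)
  define U V where "U x = u (1 / r * x)" and "V x = r * (y (1 / r * x) - s * \<tau> * f (u (1 / r * x)))" for x
  have hyp: "hyp_front f \<tau> (s / sqrt (1 + s\<^sup>2 * \<tau>)) U V"
    using hyp_front_of_normal_front[OF nf tau r_def] by (simp add: U_def[abs_def] V_def[abs_def] r_def)
  have u_mono: "u a \<le> u b" if "a \<le> b" for a b
    using nf y(1) that
    by (intro DERIV_nonneg_imp_nondecreasing[of a b u]) (auto simp: normal_front_def intro: less_imp_le)
  have "mono U"
    unfolding U_def using r by (intro monoI u_mono) (simp add: divide_right_mono)
  moreover have UV: "U x > 0 \<and> V x > 0" for x
    using u y r by (simp add: U_def V_def)
  moreover have "exp_convergent U V"
    unfolding exp_convergent_def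
  proof (rule exI[of _ C], rule exI[of _ "\<mu> / r"], intro conjI allI impI)
    show "0 < C" "0 < \<mu> / r" using C r by auto
    fix x
    \<comment> \<open>Since \<open>r \<le> 1\<close>, the unscaled flux bounds \<open>V\<close>; the
      change of variable only turns the rate \<mu> into \<open>\<mu> / r\<close>.\<close>
    have V: "\<bar>V x\<bar> \<le> y (1 / r * x) - s * \<tau> * f (u (1 / r * x))"
      using UV[of x] y(2)[of "1 / r * x"] r by (simp add: V_def mult_left_le_one_le)
    show "\<bar>U x\<bar> + \<bar>V x\<bar> \<le> C * exp (\<mu> / r * x)" if "x \<le> 0"
    proof -
      have "1 / r * x \<le> 0" using that r by (simp add: divide_nonpos_pos)
      from C(3)[OF this] V show ?thesis using u(1)[of "1 / r * x"] by (simp add: U_def)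
    qed
    show "\<bar>U x - 1\<bar> + \<bar>V x\<bar> \<le> C * exp (- (\<mu> / r) * x)" if "0 \<le> x"
    proof -
      have "0 \<le> 1 / r * x" using that r by simp
      from C(4)[OF this] V show ?thesis using u(2)[of "1 / r * x"] by (simp add: U_def)
    qed
  qed
  ultimately show ?thesis using hyp by blast
qed

end

theorem theorem1p1:
  fixes f :: "real \<Rightarrow> real" and \<alpha> :: real
  assumes "smooth_real f" and "bistable f \<alpha>"
  shows "\<exists>cs :: real \<Rightarrow> real.
    (\<forall>\<tau>. 0 < \<tau> \<and> \<tau> < tau_max f \<longrightarrow>
       \<bar>cs \<tau>\<bar> < 1 / sqrt \<tau> \<and>
       (\<forall>c. \<bar>c\<bar> < 1 / sqrt \<tau> \<and> (\<exists>U V. hyp_front f \<tau> c U V) \<longrightarrow> c = cs \<tau>) \<and>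
       (\<exists>U V. hyp_front f \<tau> (cs \<tau>) U V \<and> mono U \<and>
          (\<forall>\<xi>. U \<xi> > 0 \<and> V \<xi> > 0) \<and> exp_convergent U V)) \<and>
    continuous_on {0<..<tau_max f} cs \<and>
    (\<exists>c0. (\<exists>U0. parab_front f c0 U0) \<and> (\<forall>c U. parab_front f c U \<longrightarrow> c = c0) \<and>
          (cs \<longlongrightarrow> c0) (at_right 0))"
proof -
  interpret bistable_reaction f "deriv f" \<alpha>
    using assms by (rule bistable_reaction_deriv)
  have tm: "0 < tau_max f" using Sup_abs_f'_pos by (simp add: tau_max_def)
  have pos: "0 < damping \<tau> x" if "\<tau> \<in> {0..<tau_max f}" "x \<in> {0..1}" for \<tau> x
    using that by (intro damping_pos) (auto simp: tau_max_def)
  \<comment> \<open>The family includes \<tau> = 0, where \<open>s\<close> and \<open>cs\<close>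
    coincide with the Allen--Cahn speed.\<close>
  define s where "s \<tau> = speed (damping \<tau>)" for \<tau>
  define cs where "cs \<tau> = s \<tau> / sqrt (1 + (s \<tau>)\<^sup>2 * \<tau>)" for \<tau>
  have den: "0 < 1 + (s \<tau>)\<^sup>2 * \<tau>" if "0 \<le> \<tau>" for \<tau>
    using that by (simp add: add_pos_nonneg)
  have "continuous_on {0..<tau_max f} s"
    unfolding s_def by (rule continuous_on_speed[OF pos])
  then have cont: "continuous_on {0..<tau_max f} cs"
    unfolding cs_def
  proof (intro continuous_intros ballI)
    fix \<tau> assume "\<tau> \<in> {0..<tau_max f}"
    then show "sqrt (1 + (s \<tau>)\<^sup>2 * \<tau>) \<noteq> 0" using den[of \<tau>] by auto
  qed
  have bound: "\<bar>cs \<tau>\<bar> < 1 / sqrt \<tau>" if "0 < \<tau>" for \<tau>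
  proof -
    have "\<bar>s \<tau>\<bar> * sqrt \<tau> = sqrt ((s \<tau>)\<^sup>2 * \<tau>)" by (simp add: real_sqrt_mult)
    also have "\<dots> < sqrt (1 + (s \<tau>)\<^sup>2 * \<tau>)" by simp
    finally show ?thesis
      using that den[of \<tau>] by (simp add: cs_def abs_divide field_simps)
  qed
  have unique: "c = cs \<tau>" if tau: "0 < \<tau>" "\<tau> < tau_max f" and c: "\<bar>c\<bar> < 1 / sqrt \<tau>"
    and hyp: "hyp_front f \<tau> c U V" for \<tau> c U V
  proof -
    \<comment> \<open>The admissible range of \<open>c\<close> is exactly what makes
      \<open>1 - c^2 * \<tau>\<close> positive and the rescaling real.\<close>
    have "\<bar>c\<bar> * sqrt \<tau> < 1" using c tau by (simp add: field_simps)
    then have "(\<bar>c\<bar> * sqrt \<tau>)\<^sup>2 < 1" using tau by (simp add: abs_square_less_1)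
    then have D: "c\<^sup>2 * \<tau> < 1" using tau by (simp add: power_mult_distrib)
    define r where "r = sqrt (1 - c\<^sup>2 * \<tau>)"
    have r: "0 < r" "r\<^sup>2 = 1 - c\<^sup>2 * \<tau>" using D by (auto simp: r_def)
    have sc: "c / r = s \<tau>"
      unfolding s_def
      by (rule normal_front_speed[OF damping_cont pos normal_front_of_hyp_front[OF hyp D r_def]])
        (use tau in auto)
    \<comment> \<open>Shows \<open>1 + s^2 * \<tau> = 1 / r^2\<close>, so that \<open>cs\<close>
      undoes the passage from \<open>c\<close> to \<open>c / r\<close>.\<close>
    have "1 + (s \<tau>)\<^sup>2 * \<tau> = (r\<^sup>2 + c\<^sup>2 * \<tau>) / r\<^sup>2"
      using r(1) by (simp add: sc[symmetric] power_divide field_simps)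
    also have "\<dots> = (1 / r)\<^sup>2" by (simp add: r(2) power_divide)
    finally have "sqrt (1 + (s \<tau>)\<^sup>2 * \<tau>) = 1 / r" using r(1) by simp
    then show ?thesis using r(1) by (simp add: cs_def sc[symmetric])
  qed
  have wave: "\<exists>U V. hyp_front f \<tau> (cs \<tau>) U V \<and> mono U \<and>
      (\<forall>\<xi>. U \<xi> > 0 \<and> V \<xi> > 0) \<and> exp_convergent U V" if "0 < \<tau>" "\<tau> < tau_max f" for \<tau>
    unfolding cs_def using that by (intro hyp_front_exists pos s_def) auto
  have cont_pos: "continuous_on {0<..<tau_max f} cs"
    by (rule continuous_on_subset[OF cont]) auto
  have parab: "\<exists>U0. parab_front f (s 0) U0"
  proof -
    obtain u y where "normal_front f (damping 0) (s 0) u y"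
      by (rule normal_front_exists[OF order_refl pos, of "s 0"]) (use tm in \<open>auto simp: s_def\<close>)
    then show ?thesis using parab_front_of_normal_front by blast
  qed
  have parab_unique: "c = s 0" if "parab_front f c U" for c U
    unfolding s_def
    by (rule normal_front_speed[OF damping_cont pos normal_front_of_parab_front[OF that]]) (use tm in auto)
  have lim: "(cs \<longlongrightarrow> s 0) (at_right 0)"
  proof -
    have "(cs \<longlongrightarrow> cs 0) (at 0 within {0..<tau_max f})"
      using cont tm by (simp add: continuous_on_def)
    \<comment> \<open>Near 0 the half-open interval is a right neighbourhood, so the parabolic limit
      is continuity of \<open>cs\<close> at its left endpoint.\<close>
    moreover have "at 0 within {0..<tau_max f} = at_right 0"
      using tm by (intro at_within_nhd[of _ "{..<tau_max f}"]) auto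
    ultimately show ?thesis by (simp add: cs_def)
  qed
  show ?thesis
  proof (intro exI[of _ cs] conjI)
    show "\<forall>\<tau>. 0 < \<tau> \<and> \<tau> < tau_max f \<longrightarrow>
       \<bar>cs \<tau>\<bar> < 1 / sqrt \<tau> \<and>
       (\<forall>c. \<bar>c\<bar> < 1 / sqrt \<tau> \<and> (\<exists>U V. hyp_front f \<tau> c U V) \<longrightarrow> c = cs \<tau>) \<and>
       (\<exists>U V. hyp_front f \<tau> (cs \<tau>) U V \<and> mono U \<and>
          (\<forall>\<xi>. U \<xi> > 0 \<and> V \<xi> > 0) \<and> exp_convergent U V)"
      using bound unique wave by blast
    show "\<exists>c0. (\<exists>U0. parab_front f c0 U0) \<and> (\<forall>c U. parab_front f c U \<longrightarrow> c = c0) \<and>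
        (cs \<longlongrightarrow> c0) (at_right 0)"
      using parab parab_unique lim by (intro exI[of _ "s 0"]) auto
  qed (rule cont_pos)
qed

end
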